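(* Let $L$ be fixed. Suppose that for some parameters with $F(\mu,\rho,\gamma,\{\lambda_\ell\},\{\epsilon_\ell\})<1-\epsilon$ (for some constant $\epsilon>0$), given $(\bm Y,\bm G_1,\dots,\bm G_L)\sim\mathcal S(n,p;\mu,\rho,\{\lambda_\ell\},\{\epsilon_\ell\})$ there exists an estimator $\mathcal X(\bm Y,\bm G_1,\dots,\bm G_L)$ achieving weak recovery. Then there exist constants $\mu'>0$ and $\epsilon'>0$ with $F(\mu',\rho,\gamma,\{\lambda_\ell\},\{\epsilon_\ell\})<1-\epsilon'$ such that, for $(\bm Y,\bm G_1,\dots,\bm G_L)\sim\mathcal S(n,p;\mu',\rho,\{\lambda_\ell\},\{\epsilon_\ell\})$, there exists a function $f=f(\bm W,\bm Y,\bm G_1,\dots,\bm G_L)$, where $\bm W$ is the external randomness, with $\mathsf{Adv}(f)=\omega(1)$ (i.e. $\mathsf{Adv}(f)\to\infty$ as $n\to\infty$). Here $\mathsf{Adv}$ is computed with parameter $\mu'$.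
   Context: Model. Fix an integer $L\ge1$ and constants $\mu>0$, $\rho\in(0,1]$, $\gamma\in(0,\infty)$, $\lambda_\ell>0$, $\epsilon_\ell\in(0,1)$. Asymptotics are as $n\to\infty$ with $p/n=1/\gamma$ (along $n$ for which $p=n/\gamma$ is an integer). $\mathcal S(n,p;\mu,\rho,\{\lambda_\ell\},\{\epsilon_\ell\})$, also denoted $\mathbb P$, is the following law: sample $\bm x\in\{-1,+1\}^n$ uniformly; independently sample $\bm z_1,\dots,\bm z_L\in\{-1,+1\}^n$ with all entries independent and $\Pr(\bm z_\ell(i)=1)=\frac{1+\rho}2$; set $\bm x_\ell(i)=\bm x(i)\bm z_\ell(i)$; sample $\bm u\sim\mathcal N(0,\mathbb I_p)$ independently. Conditionally on $\bm x,\bm x_1,\dots,\bm x_L$ the observations are independent: $\bm Y=\sqrt{\mu/n}\,\bm x\bm u^\top+\bm Z\in\mathbb R^{n\times p}$ with $\bm Z$ having i.i.d. $\mathcal N(0,1)$ entries, and $\bm G_\ell$ is a random graph on $[n]$ in which each pair $i<j$ is an edge independently with probability $\frac{(1+\epsilon_\ell)\lambda_\ell}n$ if $\bm x_\ell(i)=\bm x_\ell(j)$ and $\frac{(1-\epsilon_\ell)\lambda_\ell}n$ otherwise. Null law $\mathbb Q$: $\bm Y$ has i.i.d. $\mathcal N(0,1)$ entries and $\bm G_\ell\sim\mathcal G(n,\lambda_\ell/n)$ are independent Erdős–Rényi graphs, independent of $\bm Y$. $F(\mu,\rho,\gamma,\{\lambda_\ell\},\{\epsilon_\ell\})=\max\big\{\frac{\mu^2}\gamma,\max_\ell\epsilon_\ell^2\lambda_\ell,\frac{\mu^2}\gamma+\sum_{\ell=1}^L\frac{\rho^4\epsilon_\ell^2\lambda_\ell}{1-(1-\rho^4)\epsilon_\ell^2\lambda_\ell}\big\}$.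 Weak recovery: an estimator $\mathcal X\in\mathbb R^{n\times n}\setminus\{0\}$ (a function of the observations, for each $n$) achieves weak recovery if $\mathbb E_{\mathbb P}\Big[\frac{\langle\mathcal X,\bm x\bm x^\top\rangle}{\|\mathcal X\|_{\mathrm F}\|\bm x\bm x^\top\|_{\mathrm F}}\Big]\ge c$ for some constant $c>0$. Truncation: $\iota\in(0,1)$ is a small constant such that, with the parameter $\mu$ in force (here $\mu'$), $\frac{(1+\iota)^2\mu^2}\gamma<1$ and $\frac{(1+\iota)^2\mu^2}\gamma+\sum_\ell\frac{\rho^4\epsilon_\ell^2\lambda_\ell}{1-(1-\rho^4)\epsilon_\ell^2\lambda_\ell}<1$; $\mathcal E_\diamond=\{(1-\iota)p\le\|\bm u\|^2\le(1+\iota)p\}$; $\widetilde{\mathbb P}=\mathbb P(\cdot\mid\mathcal E_\diamond)$. External randomness: $\bm W\in\mathbb R^{n\times p}$ has i.i.d. $\mathcal N(0,1)$ entries, independent of everything else. $\widetilde{\mathbb P}_\bullet$ (resp. $\mathbb Q_\bullet$) is the joint law of $(\bm Y,\bm G_1,\dots,\bm G_L)\sim\widetilde{\mathbb P}$ (resp. $\sim\mathbb Q$) and $\bm W$. $\mathsf{Adv}(f)=\mathbb E_{\widetilde{\mathbb P}_\bullet}[f]\big/\sqrt{\mathbb E_{\mathbb Q_\bullet}[f^2]}$. *)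

theory Defs
  imports "HOL-Probability.Probability"
begin

section \<open>Gaussian arrays and random graphs\<close>

text \<open>
  Rows, columns and vertices are numbered from 0, and so are the \<open>L\<close> graphs. Vectors and
  matrices are extensional functions on their finite index sets, as in \<^term>\<open>PiM\<close>.
\<close>

definition gauss :: "'i set \<Rightarrow> ('i \<Rightarrow> real) measure" where
  "gauss I = PiM I (\<lambda>_. density lborel std_normal_density)"

definition mat_space :: "nat \<Rightarrow> nat \<Rightarrow> (nat \<times> nat \<Rightarrow> real) measure" where
  "mat_space n p = PiM ({..<n} \<times> {..<p}) (\<lambda>_. borel)"

definition vertex_pairs :: "nat \<Rightarrow> (nat \<times> nat) set" where
  "vertex_pairs n = {(i, j). i < j \<and> j < n}"

text \<open>
  A simple graph on \<open>{..<n}\<close> is the indicator of its edges among the pairs \<open>i < j\<close>; a graph tuple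
  lists \<open>L\<close> of them.
\<close>

type_synonym graphs = "nat \<Rightarrow> nat \<times> nat \<Rightarrow> bool"

definition graph_tuples :: "nat \<Rightarrow> nat \<Rightarrow> graphs set" where
  "graph_tuples L n = {..<L} \<rightarrow>\<^sub>E (vertex_pairs n \<rightarrow>\<^sub>E UNIV)"

text \<open>
  \<^const>\<open>bernoulli_pmf\<close> clamps its parameter to \<open>[0, 1]\<close>, which matters only for the finitely many
  \<open>n\<close> with \<open>(1 + \<epsilon>) * \<lambda> > n\<close>.
\<close>

definition sbm_pmf :: "nat \<Rightarrow> real \<Rightarrow> real \<Rightarrow> (nat \<Rightarrow> real) \<Rightarrow> (nat \<times> nat \<Rightarrow> bool) pmf" where
  "sbm_pmf n lam eps x = Pi_pmf (vertex_pairs n) undefined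
     (\<lambda>(i, j). bernoulli_pmf
        (if x i = x j then (1 + eps) * lam / real n else (1 - eps) * lam / real n))"

definition erdos_renyi_pmf :: "nat \<Rightarrow> real \<Rightarrow> (nat \<times> nat \<Rightarrow> bool) pmf" where
  "erdos_renyi_pmf n lam =
     Pi_pmf (vertex_pairs n) undefined (\<lambda>_. bernoulli_pmf (lam / real n))"


section \<open>The planted and the null model\<close>

definition sign_pmf :: "real \<Rightarrow> real pmf" where
  "sign_pmf q = map_pmf (\<lambda>b. if b then 1 else -1) (bernoulli_pmf q)"

text \<open>
  The joint law of \<open>x\<close>, \<open>(z\<^sub>l)\<close> and the graphs, the \<open>l\<close>-th of which has community labels
  \<open>x\<^sub>l(i) = x(i) z\<^sub>l(i)\<close>.
\<close>

definition labels_graphs_pmf ::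
  "nat \<Rightarrow> nat \<Rightarrow> real \<Rightarrow> (nat \<Rightarrow> real) \<Rightarrow> (nat \<Rightarrow> real) \<Rightarrow>
     ((nat \<Rightarrow> real) \<times> (nat \<Rightarrow> nat \<Rightarrow> real) \<times> graphs) pmf" where
  "labels_graphs_pmf L n \<rho> lam eps = do {
     x \<leftarrow> Pi_pmf {..<n} undefined (\<lambda>_. pmf_of_set {-1, 1});
     z \<leftarrow> Pi_pmf {..<L} undefined
            (\<lambda>_. Pi_pmf {..<n} undefined (\<lambda>_. sign_pmf ((1 + \<rho>) / 2)));
     G \<leftarrow> Pi_pmf {..<L} undefined (\<lambda>l. sbm_pmf n (lam l) (eps l) (\<lambda>i. x i * z l i));
     return_pmf (x, z, G)
   }"

type_synonym sample =
  "((nat \<Rightarrow> real) \<times> (nat \<Rightarrow> nat \<Rightarrow> real) \<times> graphs) \<times> (nat \<Rightarrow> real) \<times> (nat \<times> nat \<Rightarrow> real)"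

text \<open>
  The planted law is carried by the samples \<open>((x, z, G), u, Z)\<close>. The observation \<open>(Y, G)\<close> is the
  random variable \<open>observe\<close> on them, and \<open>\<mu>\<close> enters only there.
\<close>

definition planted ::
  "nat \<Rightarrow> nat \<Rightarrow> nat \<Rightarrow> real \<Rightarrow> (nat \<Rightarrow> real) \<Rightarrow> (nat \<Rightarrow> real) \<Rightarrow> sample measure" where
  "planted L n p \<rho> lam eps =
     measure_pmf (labels_graphs_pmf L n \<rho> lam eps) \<Otimes>\<^sub>M
       (gauss {..<p} \<Otimes>\<^sub>M gauss ({..<n} \<times> {..<p}))"

type_synonym observation = "(nat \<times> nat \<Rightarrow> real) \<times> graphs"

definition observe :: "nat \<Rightarrow> nat \<Rightarrow> real \<Rightarrow> sample \<Rightarrow> observation" where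
  "observe n p \<mu> = (\<lambda>((x, z, G), u, Z).
     (\<lambda>(i, j)\<in>{..<n} \<times> {..<p}. sqrt (\<mu> / real n) * x i * u j + Z (i, j), G))"

definition obs_space :: "nat \<Rightarrow> nat \<Rightarrow> observation measure" where
  "obs_space n p = mat_space n p \<Otimes>\<^sub>M count_space UNIV"

definition null_law :: "nat \<Rightarrow> nat \<Rightarrow> nat \<Rightarrow> (nat \<Rightarrow> real) \<Rightarrow> observation measure" where
  "null_law L n p lam = gauss ({..<n} \<times> {..<p}) \<Otimes>\<^sub>M
     measure_pmf (Pi_pmf {..<L} undefined (\<lambda>l. erdos_renyi_pmf n (lam l)))"


section \<open>Asymptotics and weak recovery\<close>

definition sizes :: "real \<Rightarrow> nat set" where
  "sizes \<gamma> = {n. n > 0 \<and> real n / \<gamma> \<in> \<nat>}"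

text \<open>For \<open>n \<in> sizes \<gamma>\<close> the floor below is exact.\<close>

definition dim_p :: "real \<Rightarrow> nat \<Rightarrow> nat" where
  "dim_p \<gamma> n = nat \<lfloor>real n / \<gamma>\<rfloor>"

definition along_sizes :: "real \<Rightarrow> nat filter" where
  "along_sizes \<gamma> = inf sequentially (principal (sizes \<gamma>))"

definition threshold_F ::
  "nat \<Rightarrow> real \<Rightarrow> real \<Rightarrow> real \<Rightarrow> (nat \<Rightarrow> real) \<Rightarrow> (nat \<Rightarrow> real) \<Rightarrow> real" where
  "threshold_F L \<mu> \<rho> \<gamma> lam eps =
     max (\<mu>\<^sup>2 / \<gamma>)
       (max (Max ((\<lambda>l. (eps l)\<^sup>2 * lam l) ` {..<L}))
          (\<mu>\<^sup>2 / \<gamma> + (\<Sum>l<L. \<rho> ^ 4 * (eps l)\<^sup>2 * lam l / (1 - (1 - \<rho> ^ 4) * (eps l)\<^sup>2 * lam l))))"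

definition frob_inner ::
  "nat \<Rightarrow> (nat \<times> nat \<Rightarrow> real) \<Rightarrow> (nat \<times> nat \<Rightarrow> real) \<Rightarrow> real" where
  "frob_inner n A B = (\<Sum>i<n. \<Sum>j<n. A (i, j) * B (i, j))"

definition frob_norm :: "nat \<Rightarrow> (nat \<times> nat \<Rightarrow> real) \<Rightarrow> real" where
  "frob_norm n A = sqrt (frob_inner n A A)"

definition outer :: "(nat \<Rightarrow> real) \<Rightarrow> nat \<times> nat \<Rightarrow> real" where
  "outer x = (\<lambda>(i, j). x i * x j)"

definition estimator :: "nat \<Rightarrow> nat \<Rightarrow> nat \<Rightarrow> (observation \<Rightarrow> nat \<times> nat \<Rightarrow> real) \<Rightarrow> bool" where
  "estimator L n p X \<longleftrightarrow>
     X \<in> obs_space n p \<rightarrow>\<^sub>M mat_space n n \<and>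
     (\<forall>Y\<in>space (mat_space n p). \<forall>G\<in>graph_tuples L n. \<exists>i<n. \<exists>j<n. X (Y, G) (i, j) \<noteq> 0)"

definition overlap ::
  "nat \<Rightarrow> nat \<Rightarrow> nat \<Rightarrow> real \<Rightarrow> real \<Rightarrow> (nat \<Rightarrow> real) \<Rightarrow> (nat \<Rightarrow> real) \<Rightarrow>
     (observation \<Rightarrow> nat \<times> nat \<Rightarrow> real) \<Rightarrow> real" where
  "overlap L n p \<mu> \<rho> lam eps X =
     (LINT \<omega>|planted L n p \<rho> lam eps.
        (let A = X (observe n p \<mu> \<omega>); B = outer (fst (fst \<omega>))
         in frob_inner n A B / (frob_norm n A * frob_norm n B)))"

definition weak_recovery ::
  "nat \<Rightarrow> real \<Rightarrow> real \<Rightarrow> real \<Rightarrow> (nat \<Rightarrow> real) \<Rightarrow> (nat \<Rightarrow> real) \<Rightarrow>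
     (nat \<Rightarrow> observation \<Rightarrow> nat \<times> nat \<Rightarrow> real) \<Rightarrow> bool" where
  "weak_recovery L \<mu> \<rho> \<gamma> lam eps X \<longleftrightarrow>
     (\<forall>n\<in>sizes \<gamma>. estimator L n (dim_p \<gamma> n) (X n)) \<and>
     (\<exists>c>0. \<forall>\<^sub>F n in along_sizes \<gamma>. overlap L n (dim_p \<gamma> n) \<mu> \<rho> lam eps (X n) \<ge> c)"


section \<open>Truncation, external randomness and advantage\<close>

definition truncation_const ::
  "nat \<Rightarrow> real \<Rightarrow> real \<Rightarrow> real \<Rightarrow> (nat \<Rightarrow> real) \<Rightarrow> (nat \<Rightarrow> real) \<Rightarrow> real \<Rightarrow> bool" where
  "truncation_const L \<mu> \<rho> \<gamma> lam eps \<iota> \<longleftrightarrow>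
     0 < \<iota> \<and> \<iota> < 1 \<and>
     (1 + \<iota>)\<^sup>2 * \<mu>\<^sup>2 / \<gamma> < 1 \<and>
     (1 + \<iota>)\<^sup>2 * \<mu>\<^sup>2 / \<gamma> +
       (\<Sum>l<L. \<rho> ^ 4 * (eps l)\<^sup>2 * lam l / (1 - (1 - \<rho> ^ 4) * (eps l)\<^sup>2 * lam l)) < 1"

definition truncation_event :: "nat \<Rightarrow> real \<Rightarrow> sample set" where
  "truncation_event p \<iota> = {(xzG, u, Z).
     (1 - \<iota>) * real p \<le> (\<Sum>j<p. (u j)\<^sup>2) \<and> (\<Sum>j<p. (u j)\<^sup>2) \<le> (1 + \<iota>) * real p}"

text \<open>\<^const>\<open>uniform_measure\<close> is conditioning on an event.\<close>

definition planted_trunc ::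
  "nat \<Rightarrow> nat \<Rightarrow> nat \<Rightarrow> real \<Rightarrow> (nat \<Rightarrow> real) \<Rightarrow> (nat \<Rightarrow> real) \<Rightarrow> real \<Rightarrow> sample measure" where
  "planted_trunc L n p \<rho> lam eps \<iota> =
     (let P = planted L n p \<rho> lam eps in uniform_measure P (truncation_event p \<iota> \<inter> space P))"

text \<open>The joint laws of \<open>(W, (Y, G))\<close>.\<close>

definition planted_ext ::
  "nat \<Rightarrow> nat \<Rightarrow> nat \<Rightarrow> real \<Rightarrow> real \<Rightarrow> (nat \<Rightarrow> real) \<Rightarrow> (nat \<Rightarrow> real) \<Rightarrow> real \<Rightarrow>
     ((nat \<times> nat \<Rightarrow> real) \<times> observation) measure" where
  "planted_ext L n p \<mu> \<rho> lam eps \<iota> = gauss ({..<n} \<times> {..<p}) \<Otimes>\<^sub>M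
     distr (planted_trunc L n p \<rho> lam eps \<iota>) (obs_space n p) (observe n p \<mu>)"

definition null_ext ::
  "nat \<Rightarrow> nat \<Rightarrow> nat \<Rightarrow> (nat \<Rightarrow> real) \<Rightarrow> ((nat \<times> nat \<Rightarrow> real) \<times> observation) measure" where
  "null_ext L n p lam = gauss ({..<n} \<times> {..<p}) \<Otimes>\<^sub>M null_law L n p lam"

definition test_function ::
  "nat \<Rightarrow> nat \<Rightarrow> nat \<Rightarrow> real \<Rightarrow> real \<Rightarrow> (nat \<Rightarrow> real) \<Rightarrow> (nat \<Rightarrow> real) \<Rightarrow> real \<Rightarrow>
     ((nat \<times> nat \<Rightarrow> real) \<times> observation \<Rightarrow> real) \<Rightarrow> bool" where
  "test_function L n p \<mu> \<rho> lam eps \<iota> f \<longleftrightarrow>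
     f \<in> borel_measurable (mat_space n p \<Otimes>\<^sub>M obs_space n p) \<and>
     integrable (null_ext L n p lam) (\<lambda>\<omega>. (f \<omega>)\<^sup>2) \<and>
     integrable (planted_ext L n p \<mu> \<rho> lam eps \<iota>) f"

definition Adv ::
  "nat \<Rightarrow> nat \<Rightarrow> nat \<Rightarrow> real \<Rightarrow> real \<Rightarrow> (nat \<Rightarrow> real) \<Rightarrow> (nat \<Rightarrow> real) \<Rightarrow> real \<Rightarrow>
     ((nat \<times> nat \<Rightarrow> real) \<times> observation \<Rightarrow> real) \<Rightarrow> real" where
  "Adv L n p \<mu> \<rho> lam eps \<iota> f =
     (LINT \<omega>|planted_ext L n p \<mu> \<rho> lam eps \<iota>. f \<omega>) /
       sqrt (LINT \<omega>|null_ext L n p lam. (f \<omega>)\<^sup>2)"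

end

theory Submission
  imports Defs "HOL-Real_Asymp.Real_Asymp"
begin

text \<open>
  External noise \<open>W\<close> splits the observation \<open>Y = sqrt (\<mu>' / n) x u\<^sup>T + Z\<close> at a slightly larger signal
  strength \<open>\<mu>' > \<mu>\<close> into \<open>Y\<^sub>1 = a Y + b W\<close> and \<open>Y\<^sub>2 = b Y - a W\<close> with \<open>a\<^sup>2 + b\<^sup>2 = 1\<close> and
  \<open>a\<^sup>2 \<mu>' = \<mu>\<close>. By rotation invariance the noises of \<open>Y\<^sub>1\<close> and \<open>Y\<^sub>2\<close> are independent and standard,
  and \<open>(Y\<^sub>1, G)\<close> is an observation of strength \<open>\<mu>\<close>, to which the given estimator applies. Let \<open>A\<close> be
  its normalised output and \<open>f = 1 + \<langle>A, Y\<^sub>2 Y\<^sub>2\<^sup>T - p I\<rangle>\<close>. Under the null law \<open>A\<close> is independent of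
  \<open>Y\<^sub>2\<close>, and Wick's formula for fourth moments bounds the second moment of \<open>f\<close> by \<open>1 + 2 p\<close>. Under
  the planted law \<open>f\<close> has mean \<open>1 + b\<^sup>2 \<mu>' / n\<close> times the mean of \<open>\<parallel>u\<parallel>\<^sup>2 \<langle>A, x x\<^sup>T\<rangle>\<close>, which is of
  order \<open>p\<close> since \<open>\<parallel>u\<parallel>\<^sup>2\<close> deviates from \<open>p\<close> by \<open>O(sqrt p)\<close>. So the advantage grows like \<open>sqrt p\<close>.
\<close>

section \<open>Rotation invariance of Gaussian arrays\<close>

abbreviation std_normal :: "real measure" where
  "std_normal \<equiv> density lborel std_normal_density"

lemma prob_space_std_normal: "prob_space std_normal"
  by (rule prob_space_normal_density) simp

lemma sets_gauss [measurable_cong]: "sets (gauss I) = sets (PiM I (\<lambda>_. borel))"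
  unfolding gauss_def by (rule sets_PiM_cong) auto

lemma space_gauss: "space (gauss I) = extensional I"
  by (simp add: gauss_def space_PiM PiE_UNIV_domain PiE_def)

lemma prob_space_gauss: "prob_space (gauss I)"
  unfolding gauss_def by (rule prob_space_PiM) (rule prob_space_std_normal)

text \<open>
  The map \<open>(x, y) \<mapsto> (a x + b y, b x - a y)\<close> factors into two one-dimensional affine substitutions:
  first replace \<open>x\<close> by \<open>a x + b y\<close>, then \<open>y\<close> by \<open>b x - a y\<close>.
\<close>

lemma nn_integral_rotate_std_normal:
  fixes h :: "real \<times> real \<Rightarrow> ennreal"
  assumes [measurable]: "h \<in> borel_measurable (borel \<Otimes>\<^sub>M borel)"
    and ab: "a\<^sup>2 + b\<^sup>2 = 1" and a: "a > 0"
  shows "(\<integral>\<^sup>+x. \<integral>\<^sup>+y. h (a * x + b * y, b * x - a * y) \<partial>std_normal \<partial>std_normal) =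
    (\<integral>\<^sup>+x. \<integral>\<^sup>+y. h (x, y) \<partial>std_normal \<partial>std_normal)"
proof -
  define phi where "phi = (\<lambda>x y. ennreal (std_normal_density x) * ennreal (std_normal_density y))"
  have [measurable]: "case_prod phi \<in> borel_measurable (borel \<Otimes>\<^sub>M borel)"
    by (simp add: phi_def)
  \<comment> \<open>The linear map is orthogonal, so it preserves the sum of squares and with it the
    joint density.\<close>
  have phi_rot: "phi (a * x + b * y) (b * x - a * y) = phi x y" for x y
  proof -
    have "(a * x + b * y)\<^sup>2 + (b * x - a * y)\<^sup>2 = (a\<^sup>2 + b\<^sup>2) * (x\<^sup>2 + y\<^sup>2)"
      by (simp add: power2_eq_square algebra_simps)
    then have "(a * x + b * y)\<^sup>2 + (b * x - a * y)\<^sup>2 = x\<^sup>2 + y\<^sup>2"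
      using ab by simp
    then show ?thesis
      by (simp add: phi_def std_normal_density_def ennreal_mult [symmetric] exp_add [symmetric]
          add_divide_distrib [symmetric] flip: diff_conv_add_uminus)
  qed
  have iter: "(\<integral>\<^sup>+x. \<integral>\<^sup>+y. g (x, y) \<partial>std_normal \<partial>std_normal) =
      (\<integral>\<^sup>+x. \<integral>\<^sup>+y. phi x y * g (x, y) \<partial>lborel \<partial>lborel)"
    if [measurable]: "g \<in> borel_measurable (borel \<Otimes>\<^sub>M borel)" for g :: "real \<times> real \<Rightarrow> ennreal"
    by (simp add: nn_integral_density nn_integral_cmult [symmetric] phi_def mult.assoc)
  have "(\<integral>\<^sup>+x. \<integral>\<^sup>+y. h (a * x + b * y, b * x - a * y) \<partial>std_normal \<partial>std_normal) =
      (\<integral>\<^sup>+x. \<integral>\<^sup>+y. phi x y * h (a * x + b * y, b * x - a * y) \<partial>lborel \<partial>lborel)"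
    using iter[of "\<lambda>(x, y). h (a * x + b * y, b * x - a * y)"] by simp
  also have "\<dots> = (\<integral>\<^sup>+y. \<integral>\<^sup>+x. phi x y * h (a * x + b * y, b * x - a * y) \<partial>lborel \<partial>lborel)"
    by (rule lborel_pair.Fubini'[symmetric]) simp
  \<comment> \<open>First substitution: for fixed \<open>y\<close> the first argument of
    \<open>h\<close> becomes the variable of integration, at the price of the Jacobian
    \<open>1 / a\<close>.\<close>
  also have "\<dots> = (\<integral>\<^sup>+y. \<bar>1 / a\<bar> * (\<integral>\<^sup>+x. phi (x / a - b * y / a) y *
      h (x, b * x / a - y / a) \<partial>lborel) \<partial>lborel)"
  proof (rule nn_integral_cong)
    fix y
    have "b * (x / a - b * y / a) - a * y = b * x / a - y / a" for x
    proof -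
      have "b * (x / a - b * y / a) - a * y = b * x / a - (a\<^sup>2 + b\<^sup>2) * y / a"
        using a by (simp add: field_simps power2_eq_square)
      then show ?thesis using ab by simp
    qed
    then show "(\<integral>\<^sup>+x. phi x y * h (a * x + b * y, b * x - a * y) \<partial>lborel) =
      \<bar>1 / a\<bar> * (\<integral>\<^sup>+x. phi (x / a - b * y / a) y * h (x, b * x / a - y / a) \<partial>lborel)"
      using a by (subst nn_integral_real_affine[where c="1 / a" and t="- (b * y / a)"])
        (simp_all add: field_simps)
  qed
  also have "\<dots> = (\<integral>\<^sup>+x. \<bar>1 / a\<bar> * (\<integral>\<^sup>+y. phi (x / a - b * y / a) y *
      h (x, b * x / a - y / a) \<partial>lborel) \<partial>lborel)"
    by (simp add: nn_integral_cmult, subst lborel_pair.Fubini') simp_all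
  \<comment> \<open>Second substitution, \<open>b * x - a * y\<close> for \<open>y\<close>: its
    Jacobian \<open>a\<close> cancels \<open>1 / a\<close>, and the arguments of the density become
    those of \<open>phi_rot\<close>.\<close>
  also have "\<dots> = (\<integral>\<^sup>+x. \<integral>\<^sup>+y. phi x y * h (x, y) \<partial>lborel \<partial>lborel)"
  proof (rule nn_integral_cong)
    fix x
    have 1: "(x / a - b * (b * x - a * y) / a) = a * x + b * y" for y
    proof -
      have "(x / a - b * (b * x - a * y) / a) = ((a\<^sup>2 + b\<^sup>2) * x - b * (b * x - a * y)) / a"
        unfolding ab by (simp add: diff_divide_distrib)
      also have "\<dots> = a * x + b * y" using a by (simp add: field_simps power2_eq_square)
      finally show ?thesis .
    qed
    have 2: "b * x / a - (b * x - a * y) / a = y" for y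
      using a by (simp add: field_simps)
    have "(\<integral>\<^sup>+y. phi (x / a - b * y / a) y * h (x, b * x / a - y / a) \<partial>lborel) =
      \<bar>- a\<bar> * (\<integral>\<^sup>+y. phi (x / a - b * (b * x + (- a) * y) / a) (b * x + (- a) * y) *
        h (x, b * x / a - (b * x + (- a) * y) / a) \<partial>lborel)"
      using a by (subst nn_integral_real_affine[where c="- a" and t="b * x"]) simp_all
    also have "\<dots> = ennreal a * (\<integral>\<^sup>+y. phi x y * h (x, y) \<partial>lborel)"
      using a by (simp add: 1 2 phi_rot)
    finally show "\<bar>1 / a\<bar> * (\<integral>\<^sup>+y. phi (x / a - b * y / a) y * h (x, b * x / a - y / a) \<partial>lborel) =
        (\<integral>\<^sup>+y. phi x y * h (x, y) \<partial>lborel)"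
      using a by (simp add: mult.assoc [symmetric] ennreal_mult [symmetric])
  qed
  also have "\<dots> = (\<integral>\<^sup>+x. \<integral>\<^sup>+y. h (x, y) \<partial>std_normal \<partial>std_normal)"
    by (rule iter[symmetric]) simp
  finally show ?thesis .
qed

text \<open>For \<open>a\<^sup>2 + b\<^sup>2 = 1\<close>, \<open>mix a b I\<close> and
  \<open>mix b (- a) I\<close> are the two rows of a symmetric orthogonal matrix acting on the pair
  of arrays. Restriction to \<open>I\<close> keeps the result in the extensional function space of
  \<open>PiM\<close>.\<close>

definition mix :: "real \<Rightarrow> real \<Rightarrow> 'i set \<Rightarrow> ('i \<Rightarrow> real) \<Rightarrow> ('i \<Rightarrow> real) \<Rightarrow> 'i \<Rightarrow> real" where
  "mix a b I z w = (\<lambda>i\<in>I. a * z i + b * w i)"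

lemma mix_measurable [measurable (raw)]:
  assumes "f \<in> M \<rightarrow>\<^sub>M PiM I (\<lambda>_. borel)" "g \<in> M \<rightarrow>\<^sub>M PiM I (\<lambda>_. borel)"
  shows "(\<lambda>x. mix a b I (f x) (g x)) \<in> M \<rightarrow>\<^sub>M PiM I (\<lambda>_. borel)"
  using assms unfolding mix_def by measurable

lemma mix_upd:
  "i \<notin> I \<Longrightarrow> mix a b (insert i I) (z(i := s)) (w(i := t)) = (mix a b I z w)(i := a * s + b * t)"
  by (auto simp: mix_def restrict_def fun_eq_iff)

text \<open>Induction over the index set: the coordinates are independent, so the two-variable
  statement treats the new coordinate while all others are fixed. With iterated integrals of
  nonnegative functions every exchange of order is free of integrability conditions.\<close>

lemma nn_integral_rotate_gauss:
  fixes h :: "('i \<Rightarrow> real) \<times> ('i \<Rightarrow> real) \<Rightarrow> ennreal"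
  assumes "finite I" and h: "h \<in> borel_measurable (PiM I (\<lambda>_. borel) \<Otimes>\<^sub>M PiM I (\<lambda>_. borel))"
    and ab: "a\<^sup>2 + b\<^sup>2 = 1" and a: "a > 0"
  shows "(\<integral>\<^sup>+z. \<integral>\<^sup>+w. h (mix a b I z w, mix b (- a) I z w) \<partial>gauss I \<partial>gauss I) =
    (\<integral>\<^sup>+z. \<integral>\<^sup>+w. h (z, w) \<partial>gauss I \<partial>gauss I)"
  using assms(1) h
proof (induction I arbitrary: h rule: finite_induct)
  case empty
  show ?case
    by (simp add: gauss_def PiM_empty nn_integral_count_space_finite mix_def)
next
  case (insert i I)
  note [measurable] = insert.prems
  let ?G = "gauss I" and ?N = "std_normal"
  interpret N: prob_space ?N by (rule prob_space_std_normal)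
  interpret P: product_prob_space "\<lambda>_::'i. ?N" ..
  interpret G: prob_space ?G by (rule prob_space_gauss)
  interpret GN: pair_sigma_finite ?G ?N ..
  interpret GG: pair_sigma_finite ?G ?G ..
  have [measurable]: "(\<lambda>x. (f x)(i := g x)) \<in> M \<rightarrow>\<^sub>M PiM (insert i I) (\<lambda>_. borel)"
    if "f \<in> M \<rightarrow>\<^sub>M PiM I (\<lambda>_. borel)" "g \<in> M \<rightarrow>\<^sub>M borel"
    for f :: "'x \<Rightarrow> 'i \<Rightarrow> real" and g and M :: "'x measure"
    using that by (intro measurable_fun_upd[where J=I]) auto
  \<comment> \<open>Peels coordinate \<open>i\<close> off both arrays and moves the two
    one-dimensional integrals innermost, where the two-variable rotation applies.\<close>
  have split: "(\<integral>\<^sup>+z. \<integral>\<^sup>+w. k (z, w) \<partial>gauss (insert i I) \<partial>gauss (insert i I)) =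
      (\<integral>\<^sup>+z. \<integral>\<^sup>+w. \<integral>\<^sup>+s. \<integral>\<^sup>+t. k (z(i := s), w(i := t)) \<partial>?N \<partial>?N \<partial>?G \<partial>?G)"
    if [measurable]: "k \<in> borel_measurable (PiM (insert i I) (\<lambda>_. borel) \<Otimes>\<^sub>M PiM (insert i I) (\<lambda>_. borel))"
    for k :: "('i \<Rightarrow> real) \<times> ('i \<Rightarrow> real) \<Rightarrow> ennreal"
  proof -
    have 1: "(\<integral>\<^sup>+z. f z \<partial>gauss (insert i I)) = (\<integral>\<^sup>+z. \<integral>\<^sup>+s. f (z(i := s)) \<partial>?N \<partial>?G)"
      if [measurable]: "f \<in> borel_measurable (PiM (insert i I) (\<lambda>_. borel))" for f :: "_ \<Rightarrow> ennreal"
      unfolding gauss_def using insert.hyps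
      by (intro P.product_nn_integral_insert) (auto cong: measurable_cong_sets sets_PiM_cong)
    have "(\<integral>\<^sup>+z. \<integral>\<^sup>+w. k (z, w) \<partial>gauss (insert i I) \<partial>gauss (insert i I)) =
      (\<integral>\<^sup>+z. \<integral>\<^sup>+s. \<integral>\<^sup>+w. \<integral>\<^sup>+t. k (z(i := s), w(i := t)) \<partial>?N \<partial>?G \<partial>?N \<partial>?G)"
    proof -
      have "(\<integral>\<^sup>+z. \<integral>\<^sup>+w. k (z, w) \<partial>gauss (insert i I) \<partial>gauss (insert i I)) =
        (\<integral>\<^sup>+z. \<integral>\<^sup>+w. \<integral>\<^sup>+t. k (z, w(i := t)) \<partial>?N \<partial>?G \<partial>gauss (insert i I))"
        by (intro nn_integral_cong 1 measurable_compose_Pair1[OF _ that])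
          (simp add: space_gauss space_PiM PiE_def)
      also have "\<dots> = (\<integral>\<^sup>+z. \<integral>\<^sup>+s. \<integral>\<^sup>+w. \<integral>\<^sup>+t. k (z(i := s), w(i := t)) \<partial>?N \<partial>?G \<partial>?N \<partial>?G)"
        by (rule 1) measurable
      finally show ?thesis .
    qed
    also have "\<dots> = (\<integral>\<^sup>+z. \<integral>\<^sup>+w. \<integral>\<^sup>+s. \<integral>\<^sup>+t. k (z(i := s), w(i := t)) \<partial>?N \<partial>?N \<partial>?G \<partial>?G)"
    proof (intro nn_integral_cong GN.Fubini')
      fix z assume "z \<in> space ?G"
      then have [measurable]: "z \<in> space (PiM I (\<lambda>_. borel))"
        by (simp add: space_gauss space_PiM PiE_def)
      show "(\<lambda>(w, s). \<integral>\<^sup>+t. k (z(i := s), w(i := t)) \<partial>?N) \<in> borel_measurable (?G \<Otimes>\<^sub>M ?N)"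
        by simp
    qed
    finally show ?thesis .
  qed
  have "(\<integral>\<^sup>+z. \<integral>\<^sup>+w. h (mix a b (insert i I) z w, mix b (- a) (insert i I) z w)
        \<partial>gauss (insert i I) \<partial>gauss (insert i I)) =
      (\<integral>\<^sup>+z. \<integral>\<^sup>+w. \<integral>\<^sup>+s. \<integral>\<^sup>+t. h ((mix a b I z w)(i := a * s + b * t),
         (mix b (- a) I z w)(i := b * s - a * t)) \<partial>?N \<partial>?N \<partial>?G \<partial>?G)"
    using split[of "\<lambda>(z, w). h (mix a b (insert i I) z w, mix b (- a) (insert i I) z w)"] insert.hyps
    by (simp add: mix_upd)
  also have "\<dots> = (\<integral>\<^sup>+z. \<integral>\<^sup>+w. \<integral>\<^sup>+s. \<integral>\<^sup>+t. h ((mix a b I z w)(i := s),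
         (mix b (- a) I z w)(i := t)) \<partial>?N \<partial>?N \<partial>?G \<partial>?G)"
  proof (rule nn_integral_cong, rule nn_integral_cong)
    fix z w
    have [measurable]: "mix a b I z w \<in> space (PiM I (\<lambda>_. borel))" for a b
      by (simp add: mix_def space_PiM)
    show "(\<integral>\<^sup>+s. \<integral>\<^sup>+t. h ((mix a b I z w)(i := a * s + b * t),
         (mix b (- a) I z w)(i := b * s - a * t)) \<partial>?N \<partial>?N) =
      (\<integral>\<^sup>+s. \<integral>\<^sup>+t. h ((mix a b I z w)(i := s), (mix b (- a) I z w)(i := t)) \<partial>?N \<partial>?N)"
      using nn_integral_rotate_std_normal[OF _ ab a,
          of "\<lambda>(s, t). h ((mix a b I z w)(i := s), (mix b (- a) I z w)(i := t))"]
      by simp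
  qed
  \<comment> \<open>The induction hypothesis is applied to the function in which coordinate
    \<open>i\<close> of both arrays has already been integrated out.\<close>
  also have "\<dots> = (\<integral>\<^sup>+z. \<integral>\<^sup>+w. \<integral>\<^sup>+s. \<integral>\<^sup>+t. h (z(i := s), w(i := t)) \<partial>?N \<partial>?N \<partial>?G \<partial>?G)"
    using insert.IH[of "\<lambda>(z, w). \<integral>\<^sup>+s. \<integral>\<^sup>+t. h (z(i := s), w(i := t)) \<partial>?N \<partial>?N"] by simp
  also have "\<dots> = (\<integral>\<^sup>+z. \<integral>\<^sup>+w. h (z, w) \<partial>gauss (insert i I) \<partial>gauss (insert i I))"
    by (rule split[symmetric]) measurable
  finally show ?case .
qed

section \<open>Quadratic forms in Gaussian arrays\<close>

definition std_normal_moment :: "nat \<Rightarrow> real" where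
  "std_normal_moment k = (LINT x|std_normal. x ^ k)"

lemma integrable_std_normal_power: "integrable std_normal (\<lambda>x. x ^ k)"
  using integrable_std_normal_moment[of k] by (simp add: integrable_density)

lemma std_normal_moment_values:
  "std_normal_moment 0 = 1" "std_normal_moment (Suc 0) = 0" "std_normal_moment 2 = 1"
  "std_normal_moment 3 = 0" "std_normal_moment 4 = 3"
proof -
  have *: "std_normal_moment k = (LINT x|lborel. std_normal_density x * x ^ k)" for k
    unfolding std_normal_moment_def by (subst integral_density) auto
  show "std_normal_moment 0 = 1" "std_normal_moment 2 = 1" "std_normal_moment 4 = 3"
    using integral_std_normal_moment_even[of 0] integral_std_normal_moment_even[of 1]
      integral_std_normal_moment_even[of 2]
    by (simp_all add: * fact_numeral)
  show "std_normal_moment (Suc 0) = 0" "std_normal_moment 3 = 0"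
    using integral_std_normal_moment_odd[of 0] integral_std_normal_moment_odd[of 1]
    by (simp_all add: * numeral_3_eq_3)
qed

lemma
  assumes "finite I"
  shows integrable_gauss_monomial: "integrable (gauss I) (\<lambda>y. \<Prod>i\<in>I. y i ^ e i)"
    and integral_gauss_monomial:
      "(LINT y|gauss I. (\<Prod>i\<in>I. y i ^ e i)) = (\<Prod>i\<in>I. std_normal_moment (e i))"
proof -
  interpret prob_space std_normal by (rule prob_space_std_normal)
  interpret product_prob_space "\<lambda>_::'a. std_normal" ..
  show "integrable (gauss I) (\<lambda>y. \<Prod>i\<in>I. y i ^ e i)"
    unfolding gauss_def using assms integrable_std_normal_power
    by (intro product_integrable_prod[of I "\<lambda>i x. x ^ e i"]) auto
  show "(LINT y|gauss I. (\<Prod>i\<in>I. y i ^ e i)) = (\<Prod>i\<in>I. std_normal_moment (e i))"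
    unfolding gauss_def std_normal_moment_def using assms integrable_std_normal_power
    by (intro product_integral_prod[of I "\<lambda>i x. x ^ e i"]) auto
qed

lemma prod_power_of_bool:
  fixes y :: "'a \<Rightarrow> real"
  assumes "finite I" "j \<in> I"
  shows "(\<Prod>i\<in>I. y i ^ of_bool (i = j)) = y j"
proof -
  have "(\<Prod>i\<in>I. y i ^ of_bool (i = j)) = (\<Prod>i\<in>I. if i = j then y j else 1)"
    by (intro prod.cong) auto
  then show ?thesis using assms by simp
qed

text \<open>Wick's (Isserlis') formula in degree four, with one term for each pairing of the
  indices. The indices may coincide in any way; if all four agree, the three pairings add up to the
  fourth moment 3.\<close>

lemma
  assumes I: "finite I" "a \<in> I" "b \<in> I" "c \<in> I" "d \<in> I"
  shows integrable_gauss_quartic: "integrable (gauss I) (\<lambda>y. y a * y b * (y c * y d))"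
    and integral_gauss_quartic: "(LINT y|gauss I. y a * y b * (y c * y d)) =
      of_bool (a = b) * of_bool (c = d) + of_bool (a = c) * of_bool (b = d) +
      of_bool (a = d) * of_bool (b = c)"
proof -
  \<comment> \<open>\<open>e i\<close> counts the occurrences of \<open>i\<close> among the four
    indices, which turns the product into a monomial with independent factors.\<close>
  define e :: "'a \<Rightarrow> nat" where
    "e = (\<lambda>i. of_bool (i = a) + of_bool (i = b) + (of_bool (i = c) + of_bool (i = d)))"
  have mono: "y a * y b * (y c * y d) = (\<Prod>i\<in>I. y i ^ e i)" for y :: "'a \<Rightarrow> real"
    using I by (simp add: e_def power_add prod.distrib prod_power_of_bool)
  show "integrable (gauss I) (\<lambda>y. y a * y b * (y c * y d))"
    unfolding mono by (rule integrable_gauss_monomial[OF I(1)])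
  have "(LINT y|gauss I. y a * y b * (y c * y d)) = (\<Prod>i\<in>I. std_normal_moment (e i))"
    unfolding mono by (rule integral_gauss_monomial[OF I(1)])
  also have "\<dots> = (\<Prod>i\<in>{a, b, c, d}. std_normal_moment (e i))"
    using I by (intro prod.mono_neutral_right) (auto simp: e_def std_normal_moment_values)
  also have "\<dots> = of_bool (a = b) * of_bool (c = d) + of_bool (a = c) * of_bool (b = d) +
      of_bool (a = d) * of_bool (b = c)"
    \<comment> \<open>Every pattern of coincidences among the four indices leaves a product of
      tabulated moments.\<close>
    by (cases "a = b"; cases "a = c"; cases "a = d"; cases "b = c"; cases "b = d"; cases "c = d")
      (auto simp: e_def std_normal_moment_values numeral_2_eq_2[symmetric]
        insert_commute)
  finally show "(LINT y|gauss I. y a * y b * (y c * y d)) =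
      of_bool (a = b) * of_bool (c = d) + of_bool (a = c) * of_bool (b = d) +
      of_bool (a = d) * of_bool (b = c)" .
qed

lemma
  assumes I: "finite I" "a \<in> I" "b \<in> I"
  shows integrable_gauss_quadratic: "integrable (gauss I) (\<lambda>y. y a * y b)"
    and integral_gauss_quadratic: "(LINT y|gauss I. y a * y b) = of_bool (a = b)"
    and integrable_gauss_linear: "integrable (gauss I) (\<lambda>y. y a)"
    and integral_gauss_linear: "(LINT y|gauss I. y a) = 0"
proof -
  define e :: "'a \<Rightarrow> nat" where "e = (\<lambda>i. of_bool (i = a) + of_bool (i = b))"
  have mono: "y a * y b = (\<Prod>i\<in>I. y i ^ e i)" for y :: "'a \<Rightarrow> real"
    using I by (simp add: e_def power_add prod.distrib prod_power_of_bool)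
  show "integrable (gauss I) (\<lambda>y. y a * y b)"
    unfolding mono by (rule integrable_gauss_monomial[OF I(1)])
  have "(LINT y|gauss I. y a * y b) = (\<Prod>i\<in>I. std_normal_moment (e i))"
    unfolding mono by (rule integral_gauss_monomial[OF I(1)])
  also have "\<dots> = (\<Prod>i\<in>{a, b}. std_normal_moment (e i))"
    using I by (intro prod.mono_neutral_right) (auto simp: e_def std_normal_moment_values)
  also have "\<dots> = of_bool (a = b)"
    by (cases "a = b") (auto simp: e_def std_normal_moment_values numeral_2_eq_2[symmetric])
  finally show "(LINT y|gauss I. y a * y b) = of_bool (a = b)" .
  show "integrable (gauss I) (\<lambda>y. y a)"
    using integrable_gauss_monomial[OF I(1), of "\<lambda>i. of_bool (i = a)"] by (simp add: prod_power_of_bool I)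
  have "(LINT y|gauss I. y a) = (\<Prod>i\<in>I. std_normal_moment (of_bool (i = a)))"
    using integral_gauss_monomial[OF I(1), of "\<lambda>i. of_bool (i = a)"] by (simp add: prod_power_of_bool I)
  also have "\<dots> = 0" using I by (intro prod_zero) (auto simp: std_normal_moment_values)
  finally show "(LINT y|gauss I. y a) = 0" .
qed

text \<open>A second-order Wick polynomial: subtracting the covariance centres each term under
  \<open>gauss I\<close>.\<close>

definition wick_form :: "'i set \<Rightarrow> ('i \<Rightarrow> 'i \<Rightarrow> real) \<Rightarrow> ('i \<Rightarrow> real) \<Rightarrow> real" where
  "wick_form I M y = (\<Sum>a\<in>I. \<Sum>b\<in>I. M a b * (y a * y b - of_bool (a = b)))"

text \<open>In the product of two centred terms the pairing inside each factor cancels, and Wick's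
  formula leaves the two pairings across the factors. For a possibly asymmetric kernel they
  contribute \<open>M a b * M a b\<close> and \<open>M a b * M b a\<close>.\<close>

lemma
  assumes I: "finite I"
  shows integrable_wick_form: "integrable (gauss I) (wick_form I M)"
    and integral_wick_form: "(LINT y|gauss I. wick_form I M y) = 0"
    and integrable_wick_form_square: "integrable (gauss I) (\<lambda>y. (wick_form I M y)\<^sup>2)"
    and integral_wick_form_square: "(LINT y|gauss I. (wick_form I M y)\<^sup>2) =
      (\<Sum>a\<in>I. \<Sum>b\<in>I. M a b * (M a b + M b a))"
proof -
  interpret prob_space "gauss I" by (rule prob_space_gauss)
  note [simp] = integrable_gauss_quadratic[OF I] integrable_gauss_quartic[OF I]
    integral_gauss_quadratic[OF I] integral_gauss_quartic[OF I] prob_space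
  show "integrable (gauss I) (wick_form I M)"
    unfolding wick_form_def by (intro Bochner_Integration.integrable_sum integrable_mult_right
      Bochner_Integration.integrable_diff) simp_all
  show "(LINT y|gauss I. wick_form I M y) = 0"
    unfolding wick_form_def by (simp add: Bochner_Integration.integral_sum)
  define q where "q = (\<lambda>(a, b) (y::'a \<Rightarrow> real). y a * y b - of_bool (a = b))"
  have sq: "(wick_form I M y)\<^sup>2 = (\<Sum>s\<in>I \<times> I. \<Sum>t\<in>I \<times> I.
      case_prod M s * case_prod M t * (q s y * q t y))" for y
    by (simp add: wick_form_def q_def sum.cartesian_product power2_eq_square sum_product
        case_prod_unfold mult_ac)
  have q_expand: "q (a, b) y * q (c, d) y = y a * y b * (y c * y d) - of_bool (c = d) * (y a * y b)
      - of_bool (a = b) * (y c * y d) + of_bool (a = b) * of_bool (c = d)" for a b c d y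
    by (simp add: q_def algebra_simps)
  have int_q: "integrable (gauss I) (\<lambda>y. q s y * q t y)" if "s \<in> I \<times> I" "t \<in> I \<times> I" for s t
    using that by (cases s; cases t) (auto simp: q_expand)
  have val_q: "(LINT y|gauss I. q (a, b) y * q (c, d) y) =
      of_bool (a = c) * of_bool (b = d) + of_bool (a = d) * of_bool (b = c)"
    if "a \<in> I" "b \<in> I" "c \<in> I" "d \<in> I" for a b c d
    using that by (simp add: q_expand)
  show "integrable (gauss I) (\<lambda>y. (wick_form I M y)\<^sup>2)"
    unfolding sq by (intro Bochner_Integration.integrable_sum integrable_mult_right int_q)
  have "(LINT y|gauss I. (wick_form I M y)\<^sup>2) = (\<Sum>s\<in>I \<times> I. \<Sum>t\<in>I \<times> I.
      case_prod M s * case_prod M t * (LINT y|gauss I. q s y * q t y))"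
    unfolding sq by (simp add: Bochner_Integration.integral_sum int_q)
  also have "\<dots> = (\<Sum>(a, b)\<in>I \<times> I. \<Sum>(c, d)\<in>I \<times> I. M a b * M c d *
      (of_bool (a = c) * of_bool (b = d) + of_bool (a = d) * of_bool (b = c)))"
    by (auto intro!: sum.cong simp: val_q)
  also have "\<dots> = (\<Sum>a\<in>I. \<Sum>b\<in>I. \<Sum>c\<in>I. \<Sum>d\<in>I. M a b * M c d *
      (of_bool (a = c) * of_bool (b = d) + of_bool (a = d) * of_bool (b = c)))"
    by (simp add: sum.cartesian_product[symmetric])
  also have "\<dots> = (\<Sum>a\<in>I. \<Sum>b\<in>I. M a b * (M a b + M b a))"
  proof (intro sum.cong refl)
    fix a b assume ab: "a \<in> I" "b \<in> I"
    have "(\<Sum>c\<in>I. \<Sum>d\<in>I. M a b * M c d *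
        (of_bool (a = c) * of_bool (b = d) + of_bool (a = d) * of_bool (b = c))) =
      (\<Sum>c\<in>I. \<Sum>d\<in>I. (if c = a then if d = b then M a b * M a b else 0 else 0) +
         (if c = b then if d = a then M a b * M b a else 0 else 0))"
      by (intro sum.cong) auto
    also have "\<dots> = M a b * (M a b + M b a)"
    proof -
      have "(\<Sum>c\<in>I. \<Sum>d\<in>I. (if c = u then if d = v then w else 0 else 0)) = w"
        if "u \<in> I" "v \<in> I" for u v and w :: real
      proof -
        have "(\<Sum>c\<in>I. \<Sum>d\<in>I. (if c = u then if d = v then w else 0 else 0)) =
          (\<Sum>c\<in>I. if c = u then (\<Sum>d\<in>I. if d = v then w else 0) else 0)"
          by (intro sum.cong) auto
        then show ?thesis using that I by simp
      qed
      then show ?thesis using ab by (simp add: sum.distrib distrib_left)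
    qed
    finally show "(\<Sum>c\<in>I. \<Sum>d\<in>I. M a b * M c d *
        (of_bool (a = c) * of_bool (b = d) + of_bool (a = d) * of_bool (b = c))) =
        M a b * (M a b + M b a)" .
  qed
  finally show "(LINT y|gauss I. (wick_form I M y)\<^sup>2) =
      (\<Sum>a\<in>I. \<Sum>b\<in>I. M a b * (M a b + M b a))" .
qed

section \<open>Splitting the observation\<close>

lemma prob_space_planted: "prob_space (planted L n p \<rho> lam eps)"
  unfolding planted_def
  by (intro prob_space_pair prob_space_gauss measure_pmf.prob_space_axioms)

lemma nn_integral_planted:
  assumes "g \<in> borel_measurable (planted L n p \<rho> lam eps)"
  shows "(\<integral>\<^sup>+\<omega>. g \<omega> \<partial>planted L n p \<rho> lam eps) =
    (\<integral>\<^sup>+q. \<integral>\<^sup>+u. \<integral>\<^sup>+Z. g (q, u, Z) \<partial>gauss ({..<n} \<times> {..<p}) \<partial>gauss {..<p}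
       \<partial>labels_graphs_pmf L n \<rho> lam eps)"
proof -
  let ?G = "gauss ({..<n} \<times> {..<p})" and ?U = "gauss {..<p}"
  interpret G: prob_space ?G by (rule prob_space_gauss)
  interpret U: prob_space ?U by (rule prob_space_gauss)
  interpret UG: pair_prob_space ?U ?G ..
  have [measurable]: "g \<in> borel_measurable
      (measure_pmf (labels_graphs_pmf L n \<rho> lam eps) \<Otimes>\<^sub>M (?U \<Otimes>\<^sub>M ?G))"
    using assms by (simp add: planted_def)
  show ?thesis
    unfolding planted_def
    by (subst UG.nn_integral_fst[symmetric]) (simp_all add: G.nn_integral_fst[symmetric])
qed

text \<open>Only the noise \<open>Z\<close> and the external \<open>W\<close> are transformed, so
  the invariance of Gaussian arrays applies inside the integral over labels, graphs and
  \<open>u\<close>. The first new array becomes the noise of the sample; the second is independent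
  of the whole sample.\<close>

lemma distr_rotate_planted:
  fixes a b :: real
  defines "T \<equiv> \<lambda>n p (W :: nat \<times> nat \<Rightarrow> real, (q, u :: nat \<Rightarrow> real, Z)).
    ((q, u, mix a b ({..<n} \<times> {..<p}) Z W), mix b (- a) ({..<n} \<times> {..<p}) Z W)"
  assumes ab: "a\<^sup>2 + b\<^sup>2 = 1" and a: "a > 0"
  shows "T n p \<in> gauss ({..<n} \<times> {..<p}) \<Otimes>\<^sub>M planted L n p \<rho> lam eps \<rightarrow>\<^sub>M
      planted L n p \<rho> lam eps \<Otimes>\<^sub>M gauss ({..<n} \<times> {..<p})"
    and "distr (gauss ({..<n} \<times> {..<p}) \<Otimes>\<^sub>M planted L n p \<rho> lam eps)
      (planted L n p \<rho> lam eps \<Otimes>\<^sub>M gauss ({..<n} \<times> {..<p})) (T n p) =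
    planted L n p \<rho> lam eps \<Otimes>\<^sub>M gauss ({..<n} \<times> {..<p})" (is "?D = ?P \<Otimes>\<^sub>M ?G")
proof -
  let ?I = "{..<n} \<times> {..<p}" and ?Q = "labels_graphs_pmf L n \<rho> lam eps" and ?U = "gauss {..<p}"
  interpret G: prob_space ?G by (rule prob_space_gauss)
  interpret P: prob_space ?P by (rule prob_space_planted)
  interpret GP: pair_prob_space ?G ?P ..
  show T [measurable]: "T n p \<in> ?G \<Otimes>\<^sub>M ?P \<rightarrow>\<^sub>M ?P \<Otimes>\<^sub>M ?G"
    unfolding T_def planted_def by measurable
  show "?D = ?P \<Otimes>\<^sub>M ?G"
  proof (rule measure_eqI)
    fix A assume "A \<in> sets ?D"
    then have A [measurable]: "A \<in> sets (?P \<Otimes>\<^sub>M ?G)" by simp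
    let ?h = "indicator A :: _ \<Rightarrow> ennreal"
    have h: "(\<lambda>z. ?h ((q, u, fst z), snd z)) \<in>
        borel_measurable (PiM ?I (\<lambda>_. borel) \<Otimes>\<^sub>M PiM ?I (\<lambda>_. borel))"
      if "u \<in> space ?U" for q u
    proof -
      have "(\<lambda>z. ((q, u, fst z), snd z)) \<in> PiM ?I (\<lambda>_. borel) \<Otimes>\<^sub>M PiM ?I (\<lambda>_. borel) \<rightarrow>\<^sub>M ?P \<Otimes>\<^sub>M ?G"
        using that unfolding planted_def by measurable
      from measurable_compose[OF this] show ?thesis by measurable
    qed
    have "emeasure ?D A = (\<integral>\<^sup>+z. ?h z \<partial>?D)"
      by simp
    also have "\<dots> = (\<integral>\<^sup>+z. ?h (T n p z) \<partial>(?G \<Otimes>\<^sub>M ?P))"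
      by (rule nn_integral_distr) measurable
    also have "\<dots> = (\<integral>\<^sup>+\<omega>. \<integral>\<^sup>+W. ?h (T n p (W, \<omega>)) \<partial>?G \<partial>?P)"
      by (rule GP.nn_integral_snd[symmetric]) measurable
    also have "\<dots> = (\<integral>\<^sup>+q. \<integral>\<^sup>+u. \<integral>\<^sup>+Z. \<integral>\<^sup>+W. ?h (T n p (W, (q, u, Z))) \<partial>?G \<partial>?G \<partial>?U \<partial>?Q)"
      by (rule nn_integral_planted) measurable
    also have "\<dots> = (\<integral>\<^sup>+q. \<integral>\<^sup>+u. \<integral>\<^sup>+Z. \<integral>\<^sup>+W. ?h ((q, u, Z), W) \<partial>?G \<partial>?G \<partial>?U \<partial>?Q)"
    proof (rule nn_integral_cong, rule nn_integral_cong)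
      fix q u assume "u \<in> space ?U"
      from nn_integral_rotate_gauss[OF _ h[OF this] ab a, of q]
      show "(\<integral>\<^sup>+Z. \<integral>\<^sup>+W. ?h (T n p (W, (q, u, Z))) \<partial>?G \<partial>?G) =
          (\<integral>\<^sup>+Z. \<integral>\<^sup>+W. ?h ((q, u, Z), W) \<partial>?G \<partial>?G)"
        by (simp add: T_def)
    qed
    also have "\<dots> = (\<integral>\<^sup>+\<omega>. \<integral>\<^sup>+W. ?h (\<omega>, W) \<partial>?G \<partial>?P)"
      by (rule nn_integral_planted[symmetric]) measurable
    also have "\<dots> = emeasure (?P \<Otimes>\<^sub>M ?G) A"
      by (simp add: G.nn_integral_fst)
    finally show "emeasure ?D A = emeasure (?P \<Otimes>\<^sub>M ?G) A" .
  qed simp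
qed

section \<open>The null law under the rotation\<close>

lemma sets_null_law: "sets (null_law L n p lam) = sets (obs_space n p)"
  unfolding null_law_def obs_space_def mat_space_def
  by (intro sets_pair_measure_cong sets_gauss) simp

lemma prob_space_null_law: "prob_space (null_law L n p lam)"
  unfolding null_law_def
  by (intro prob_space_pair prob_space_gauss measure_pmf.prob_space_axioms)

text \<open>Under the null law \<open>Y\<close> is itself standard noise, independent of
  \<open>W\<close> and of the graphs, so the two mixtures are independent standard arrays. Hence the
  first argument of \<open>F\<close>, which will feed the estimator, is independent of the
  second.\<close>

lemma nn_integral_rotate_null:
  fixes a b :: real and F :: "observation \<Rightarrow> (nat \<times> nat \<Rightarrow> real) \<Rightarrow> ennreal"
  assumes ab: "a\<^sup>2 + b\<^sup>2 = 1" and a: "a > 0"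
    and F [measurable]: "case_prod F \<in> borel_measurable (obs_space n p \<Otimes>\<^sub>M mat_space n p)"
  shows "(\<integral>\<^sup>+(W, Y, G). F (mix a b ({..<n} \<times> {..<p}) Y W, G)
        (mix b (- a) ({..<n} \<times> {..<p}) Y W) \<partial>null_ext L n p lam) =
    (\<integral>\<^sup>+z. \<integral>\<^sup>+y. F z y \<partial>gauss ({..<n} \<times> {..<p}) \<partial>null_law L n p lam)"
proof -
  let ?I = "{..<n} \<times> {..<p}"
  let ?G = "gauss ?I" and ?N = "null_law L n p lam"
  let ?Q = "measure_pmf (Pi_pmf {..<L} undefined (\<lambda>l. erdos_renyi_pmf n (lam l)))"
  interpret G: prob_space ?G by (rule prob_space_gauss)
  interpret N: prob_space ?N by (rule prob_space_null_law)
  interpret GN: pair_prob_space ?G ?N ..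
  interpret GQ: pair_prob_space ?G ?Q ..
  have F' [measurable]: "case_prod F \<in> borel_measurable
      ((PiM ?I (\<lambda>_. borel) \<Otimes>\<^sub>M count_space UNIV) \<Otimes>\<^sub>M PiM ?I (\<lambda>_. borel))"
    using F by (simp add: obs_space_def mat_space_def)
  have "(\<integral>\<^sup>+(W, Y, G). F (mix a b ?I Y W, G) (mix b (- a) ?I Y W) \<partial>null_ext L n p lam) =
    (\<integral>\<^sup>+z. \<integral>\<^sup>+W. F (mix a b ?I (fst z) W, snd z) (mix b (- a) ?I (fst z) W) \<partial>?G \<partial>?N)"
    unfolding null_ext_def null_law_def
    by (subst GN.nn_integral_snd[unfolded null_law_def, symmetric]) (simp_all add: case_prod_unfold)
  also have "\<dots> = (\<integral>\<^sup>+g. \<integral>\<^sup>+Y. \<integral>\<^sup>+W. F (mix a b ?I Y W, g) (mix b (- a) ?I Y W)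
      \<partial>?G \<partial>?G \<partial>?Q)"
    unfolding null_law_def by (subst GQ.nn_integral_snd[symmetric]) simp_all
  also have "\<dots> = (\<integral>\<^sup>+g. \<integral>\<^sup>+Y. \<integral>\<^sup>+W. F (Y, g) W \<partial>?G \<partial>?G \<partial>?Q)"
    using nn_integral_rotate_gauss[OF _ _ ab a, of ?I "\<lambda>(Y, W). F (Y, g) W" for g] by simp
  also have "\<dots> = (\<integral>\<^sup>+z. \<integral>\<^sup>+y. F z y \<partial>?G \<partial>?N)"
    unfolding null_law_def by (subst GQ.nn_integral_snd[symmetric]) simp_all
  finally show ?thesis .
qed

section \<open>The test statistic\<close>

lemma wick_form_cong:
  "(\<And>i. i \<in> I \<Longrightarrow> y i = y' i) \<Longrightarrow> wick_form I M y = wick_form I M y'"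
  unfolding wick_form_def by (intro sum.cong) auto

lemma borel_measurable_wick_form:
  assumes "\<And>a b. a \<in> I \<Longrightarrow> b \<in> I \<Longrightarrow> (\<lambda>x. M x a b) \<in> borel_measurable N"
    and "f \<in> N \<rightarrow>\<^sub>M PiM I (\<lambda>_. borel)"
  shows "(\<lambda>x. wick_form I (M x) (f x)) \<in> borel_measurable N"
  unfolding wick_form_def using assms by (intro borel_measurable_sum) (simp, measurable)

text \<open>Expanding around the mean \<open>m\<close> leaves the centred form, two linear cross
  terms and the form in \<open>m\<close> alone; all but the last have mean zero.\<close>

lemma
  assumes I: "finite I"
  shows integrable_wick_form_shift: "integrable (gauss I) (\<lambda>y. wick_form I M (\<lambda>i. m i + y i))"
    and integral_wick_form_shift: "(LINT y|gauss I. wick_form I M (\<lambda>i. m i + y i)) =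
      (\<Sum>a\<in>I. \<Sum>b\<in>I. M a b * (m a * m b))"
proof -
  interpret prob_space "gauss I" by (rule prob_space_gauss)
  have *: "wick_form I M (\<lambda>i. m i + y i) = wick_form I M y + (\<Sum>a\<in>I. \<Sum>b\<in>I. M a b * (m a * y b))
      + (\<Sum>a\<in>I. \<Sum>b\<in>I. M a b * (m b * y a)) + (\<Sum>a\<in>I. \<Sum>b\<in>I. M a b * (m a * m b))" for y
    unfolding wick_form_def sum.distrib[symmetric] by (intro sum.cong refl) (simp add: algebra_simps)
  have lin: "integrable (gauss I) (\<lambda>y. y a)" "(LINT y|gauss I. y a) = 0" if "a \<in> I" for a
    using integrable_gauss_linear[OF I that that] integral_gauss_linear[OF I that that] by auto
  have i1: "integrable (gauss I) (\<lambda>y. \<Sum>a\<in>I. \<Sum>b\<in>I. M a b * (m a * y b))"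
    and i2: "integrable (gauss I) (\<lambda>y. \<Sum>a\<in>I. \<Sum>b\<in>I. M a b * (m b * y a))"
    by (intro Bochner_Integration.integrable_sum integrable_mult_right lin; simp)+
  show "integrable (gauss I) (\<lambda>y. wick_form I M (\<lambda>i. m i + y i))"
    unfolding * using i1 i2 integrable_wick_form[OF I] by simp
  show "(LINT y|gauss I. wick_form I M (\<lambda>i. m i + y i)) =
      (\<Sum>a\<in>I. \<Sum>b\<in>I. M a b * (m a * m b))"
    unfolding * using i1 i2 integrable_wick_form[OF I]
    by (simp add: integral_wick_form[OF I] Bochner_Integration.integral_sum lin prob_space)
qed

text \<open>Supplies a majorant that depends on the kernel and the shift only through their bounds,
  so that one integrable function serves for all samples. It comes from
  \<open>2 * s * t \<le> s\<^sup>2 + t\<^sup>2\<close>, used on the product and again on each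
  square.\<close>

lemma abs_wick_form_shift_le:
  assumes I: "finite I" and M: "\<And>a b. a \<in> I \<Longrightarrow> b \<in> I \<Longrightarrow> \<bar>M a b\<bar> \<le> 1" and m: "\<And>a. a \<in> I \<Longrightarrow> (m a)\<^sup>2 \<le> K"
  shows "\<bar>wick_form I M (\<lambda>i. m i + y i)\<bar> \<le>
    (\<Sum>a\<in>I. \<Sum>b\<in>I. 1 + 2 * K + y a * y a + y b * y b)"
proof -
  have "\<bar>M a b * ((m a + y a) * (m b + y b) - of_bool (a = b))\<bar> \<le>
      1 + 2 * K + y a * y a + y b * y b" if "a \<in> I" "b \<in> I" for a b
  proof -
    have sq: "(s + t)\<^sup>2 \<le> 2 * s\<^sup>2 + 2 * t\<^sup>2" for s t :: real
      using sum_squares_bound[of s t] by (simp add: power2_sum)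
    have "\<bar>(m a + y a) * (m b + y b)\<bar> \<le> ((m a + y a)\<^sup>2 + (m b + y b)\<^sup>2) / 2"
      using sum_squares_bound[of "\<bar>m a + y a\<bar>" "\<bar>m b + y b\<bar>"] by (simp add: abs_mult)
    also have "\<dots> \<le> 2 * K + y a * y a + y b * y b"
      using sq[of "m a" "y a"] sq[of "m b" "y b"] m[OF that(1)] m[OF that(2)]
      by (simp add: power2_eq_square)
    finally have "\<bar>(m a + y a) * (m b + y b) - of_bool (a = b)\<bar> \<le>
        1 + 2 * K + y a * y a + y b * y b" (is "?l \<le> ?r")
      using abs_triangle_ineq4[of "(m a + y a) * (m b + y b)" "of_bool (a = b)"] by (cases "a = b") auto
    then show ?thesis
      using mult_mono[OF M[OF that] \<open>?l \<le> ?r\<close>] by (simp add: abs_mult)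
  qed
  then have "(\<Sum>a\<in>I. \<Sum>b\<in>I. \<bar>M a b * ((m a + y a) * (m b + y b) - of_bool (a = b))\<bar>) \<le>
      (\<Sum>a\<in>I. \<Sum>b\<in>I. 1 + 2 * K + y a * y a + y b * y b)"
    by (intro sum_mono) auto
  then show ?thesis
    unfolding wick_form_def by (rule order_trans[rotated])
      (intro order_trans[OF sum_abs] sum_mono order_trans[OF sum_abs] order_refl)
qed

section \<open>Normalised matrices and the Frobenius norm\<close>

text \<open>The zero matrix is sent to itself, since \<open>x / 0 = 0\<close>.\<close>

definition unit_mat :: "nat \<Rightarrow> (nat \<times> nat \<Rightarrow> real) \<Rightarrow> nat \<times> nat \<Rightarrow> real" where
  "unit_mat n A = (\<lambda>ij. A ij / frob_norm n A)"

lemma frob_inner_self: "frob_inner n A A = (\<Sum>i<n. \<Sum>j<n. (A (i, j))\<^sup>2)"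
  by (simp add: frob_inner_def power2_eq_square)

lemma frob_inner_self_nonneg: "0 \<le> frob_inner n A A"
  by (auto simp: frob_inner_self intro!: sum_nonneg)

lemma frob_norm_square: "(frob_norm n A)\<^sup>2 = frob_inner n A A"
  by (simp add: frob_norm_def frob_inner_self_nonneg)

text \<open>The value is 1 unless all entries of \<open>A\<close> in the block vanish; then it is 0,
  hence an inequality.\<close>

lemma frob_inner_unit_mat_self: "frob_inner n (unit_mat n A) (unit_mat n A) \<le> 1"
proof -
  have "frob_inner n (unit_mat n A) (unit_mat n A) = frob_inner n A A / (frob_norm n A)\<^sup>2"
    by (simp add: frob_inner_self unit_mat_def power_divide sum_divide_distrib)
  then show ?thesis by (simp add: frob_norm_square)
qed

lemma frob_inner_unit_mat: "frob_inner n (unit_mat n A) B = frob_inner n A B / frob_norm n A"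
  by (simp add: frob_inner_def unit_mat_def sum_divide_distrib)

lemma frob_cauchy_schwarz: "\<bar>frob_inner n A B\<bar> \<le> frob_norm n A * frob_norm n B"
proof -
  have "(\<Sum>s\<in>{..<n} \<times> {..<n}. A s * B s)\<^sup>2 \<le>
      (\<Sum>s\<in>{..<n} \<times> {..<n}. (A s)\<^sup>2) * (\<Sum>s\<in>{..<n} \<times> {..<n}. (B s)\<^sup>2)"
    by (rule Cauchy_Schwarz_ineq_sum)
  then have "(frob_inner n A B)\<^sup>2 \<le> (frob_norm n A * frob_norm n B)\<^sup>2"
    unfolding power_mult_distrib frob_norm_square frob_inner_self
    by (simp add: frob_inner_def sum.cartesian_product case_prod_unfold)
  then show ?thesis
    by (metis abs_le_square_iff abs_of_nonneg frob_norm_def frob_inner_self_nonneg mult_nonneg_nonneg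
        real_sqrt_ge_zero)
qed

lemma borel_measurable_frob_inner [measurable (raw)]:
  assumes [measurable]: "f \<in> N \<rightarrow>\<^sub>M mat_space n n" and "g \<in> N \<rightarrow>\<^sub>M mat_space n n"
  shows "(\<lambda>x. frob_inner n (f x) (g x)) \<in> borel_measurable N"
  using assms unfolding frob_inner_def mat_space_def by measurable

lemma borel_measurable_unit_mat:
  assumes f: "f \<in> N \<rightarrow>\<^sub>M mat_space n n" and "i < n" "j < n"
  shows "(\<lambda>x. unit_mat n (f x) (i, j)) \<in> borel_measurable N"
proof -
  have [measurable]: "(\<lambda>x. f x (i, j)) \<in> borel_measurable N"
    using measurable_compose[OF f[unfolded mat_space_def] measurable_component_singleton[of "(i, j)"]]
      assms by simp
  note [measurable] = f
  show ?thesis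
    unfolding unit_mat_def frob_norm_def by measurable
qed

text \<open>The kernel turning the form in \<open>y\<close> into the Frobenius product of \<open>A\<close> with \<open>y y\<^sup>T - p I\<close>.\<close>

definition gram_kernel :: "(nat \<times> nat \<Rightarrow> real) \<Rightarrow> nat \<times> nat \<Rightarrow> nat \<times> nat \<Rightarrow> real" where
  "gram_kernel A = (\<lambda>(i, k) (j, l). A (i, j) * of_bool (k = l))"

lemma sum_gram_kernel:
  "(\<Sum>a\<in>{..<n} \<times> {..<p}. \<Sum>b\<in>{..<n} \<times> {..<p}. gram_kernel A a b * g a b) =
    (\<Sum>i<n. \<Sum>j<n. \<Sum>k<p. A (i, j) * g (i, k) (j, k))"
proof -
  have "(\<Sum>a\<in>{..<n} \<times> {..<p}. \<Sum>b\<in>{..<n} \<times> {..<p}. gram_kernel A a b * g a b) =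
      (\<Sum>i<n. \<Sum>k<p. \<Sum>j<n. \<Sum>l<p. A (i, j) * of_bool (k = l) * g (i, k) (j, l))"
    by (simp add: sum.cartesian_product' gram_kernel_def)
  also have "\<dots> = (\<Sum>i<n. \<Sum>k<p. \<Sum>j<n. \<Sum>l<p. if k = l then A (i, j) * g (i, k) (j, l) else 0)"
    by (intro sum.cong) auto
  also have "\<dots> = (\<Sum>i<n. \<Sum>k<p. \<Sum>j<n. A (i, j) * g (i, k) (j, k))"
    by (intro sum.cong refl) simp
  also have "\<dots> = (\<Sum>i<n. \<Sum>j<n. \<Sum>k<p. A (i, j) * g (i, k) (j, k))"
    by (intro sum.cong refl sum.swap)
  finally show ?thesis .
qed

text \<open>The left side is the variance of the Wick form with this kernel. Each entry of the
  normalised matrix occurs \<open>p\<close> times in the kernel, so the squares of the kernel sum to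
  at most \<open>p\<close>, and the transposed term at most doubles this.\<close>

lemma sum_gram_kernel_unit_mat_le:
  defines "M \<equiv> \<lambda>n A. gram_kernel (unit_mat n A)"
  shows "(\<Sum>a\<in>{..<n} \<times> {..<p}. \<Sum>b\<in>{..<n} \<times> {..<p}. M n A a b * (M n A a b + M n A b a)) \<le> 2 * real p"
proof -
  let ?I = "{..<n} \<times> {..<p}"
  let ?M = "M n A"
  \<comment> \<open>The product \<open>?M a b * ?M b a\<close> is at most half the sum of the two
    squares; after summation both squares have the same total.\<close>
  have le: "?M a b * (?M a b + ?M b a) \<le> 3 / 2 * (?M a b)\<^sup>2 + 1 / 2 * (?M b a)\<^sup>2" for a b
    using sum_squares_bound[of "?M a b" "?M b a"] by (simp add: power2_eq_square algebra_simps)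
  have "(\<Sum>a\<in>?I. \<Sum>b\<in>?I. ?M a b * (?M a b + ?M b a)) \<le>
      (\<Sum>a\<in>?I. \<Sum>b\<in>?I. 3 / 2 * (?M a b)\<^sup>2 + 1 / 2 * (?M b a)\<^sup>2)"
    by (intro sum_mono le)
  also have "\<dots> = 3 / 2 * (\<Sum>a\<in>?I. \<Sum>b\<in>?I. (?M a b)\<^sup>2) + 1 / 2 * (\<Sum>a\<in>?I. \<Sum>b\<in>?I. (?M b a)\<^sup>2)"
    by (simp only: sum.distrib sum_distrib_left)
  also have "(\<Sum>a\<in>?I. \<Sum>b\<in>?I. (?M b a)\<^sup>2) = (\<Sum>a\<in>?I. \<Sum>b\<in>?I. (?M a b)\<^sup>2)"
    by (rule sum.swap)
  also have "(\<Sum>a\<in>?I. \<Sum>b\<in>?I. (?M a b)\<^sup>2) = p * frob_inner n (unit_mat n A) (unit_mat n A)"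
  proof -
    have "(\<Sum>a\<in>?I. \<Sum>b\<in>?I. (?M a b)\<^sup>2) = (\<Sum>i<n. \<Sum>j<n. \<Sum>k<p. unit_mat n A (i, j) * ?M (i, k) (j, k))"
      unfolding M_def sum_gram_kernel[symmetric] by (simp add: power2_eq_square)
    then show ?thesis
      by (simp add: M_def gram_kernel_def frob_inner_def sum_distrib_left)
  qed
  also have "3 / 2 * (p * frob_inner n (unit_mat n A) (unit_mat n A)) +
      1 / 2 * (p * frob_inner n (unit_mat n A) (unit_mat n A)) \<le> 2 * real p"
    using mult_left_mono[OF frob_inner_unit_mat_self[of n A], of "real p"] by simp
  finally show ?thesis .
qed

lemma abs_unit_mat_le: "i < n \<Longrightarrow> j < n \<Longrightarrow> \<bar>unit_mat n A (i, j)\<bar> \<le> 1"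
proof -
  assume "i < n" "j < n"
  then have "(unit_mat n A (i, j))\<^sup>2 \<le> (\<Sum>j<n. (unit_mat n A (i, j))\<^sup>2)"
    by (intro member_le_sum) auto
  also have "\<dots> \<le> frob_inner n (unit_mat n A) (unit_mat n A)"
    unfolding frob_inner_self using \<open>i < n\<close>
    by (intro member_le_sum[where f="\<lambda>i. \<Sum>j<n. (unit_mat n A (i, j))\<^sup>2"]) (auto intro: sum_nonneg)
  finally have "(unit_mat n A (i, j))\<^sup>2 \<le> 1"
    using frob_inner_unit_mat_self[of n A] by linarith
  then show ?thesis by (simp add: abs_square_le_1)
qed

text \<open>
  Without the summand 1 the statistic may vanish identically, for instance if \<open>X\<close> is antisymmetric,
  and its advantage would be the junk value \<open>0 / 0 = 0\<close>.
\<close>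

definition test_stat ::
  "nat \<Rightarrow> nat \<Rightarrow> real \<Rightarrow> real \<Rightarrow> (observation \<Rightarrow> nat \<times> nat \<Rightarrow> real) \<Rightarrow>
     (nat \<times> nat \<Rightarrow> real) \<times> observation \<Rightarrow> real" where
  "test_stat n p a b X = (\<lambda>(W, Y, G). let I = {..<n} \<times> {..<p} in
     1 + wick_form I (gram_kernel (unit_mat n (X (mix a b I Y W, G)))) (mix b (- a) I Y W))"

lemma borel_measurable_gram_form:
  assumes "f \<in> N \<rightarrow>\<^sub>M mat_space n n" and "g \<in> N \<rightarrow>\<^sub>M mat_space n p"
  shows "(\<lambda>x. wick_form ({..<n} \<times> {..<p}) (gram_kernel (unit_mat n (f x))) (g x)) \<in> borel_measurable N"
  using assms
  by (intro borel_measurable_wick_form)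
    (auto simp: gram_kernel_def mat_space_def[of n p]
      intro!: borel_measurable_times borel_measurable_unit_mat)

lemma borel_measurable_test_stat:
  assumes X [measurable]: "X \<in> obs_space n p \<rightarrow>\<^sub>M mat_space n n"
  shows "test_stat n p a b X \<in> borel_measurable (mat_space n p \<Otimes>\<^sub>M obs_space n p)"
proof -
  have rot: "(\<lambda>(W, Y, G). mix a b ({..<n} \<times> {..<p}) Y W) \<in>
      mat_space n p \<Otimes>\<^sub>M obs_space n p \<rightarrow>\<^sub>M mat_space n p" for a b
    unfolding mat_space_def obs_space_def by measurable
  have "(\<lambda>(W, Y, G). (mix a b ({..<n} \<times> {..<p}) Y W, G)) \<in>
      mat_space n p \<Otimes>\<^sub>M obs_space n p \<rightarrow>\<^sub>M obs_space n p"
    unfolding mat_space_def obs_space_def by measurable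
  from measurable_compose[OF this X] rot[of b "- a"]
  show ?thesis
    unfolding test_stat_def Let_def case_prod_unfold
    by (intro borel_measurable_add borel_measurable_const borel_measurable_gram_form)
qed

text \<open>Given the observation \<open>z\<close> handed to the estimator, the kernel is fixed and
  the second array is standard noise. The form is then centred, so the second moment is 1 plus its
  variance. The lower bound keeps the denominator of the advantage away from 0.\<close>

lemma nn_integral_null_test_stat:
  assumes X [measurable]: "X \<in> obs_space n p \<rightarrow>\<^sub>M mat_space n n"
    and ab: "a\<^sup>2 + b\<^sup>2 = 1" and a: "a > 0"
  shows "1 \<le> (\<integral>\<^sup>+\<omega>. ennreal ((test_stat n p a b X \<omega>)\<^sup>2) \<partial>null_ext L n p lam)"
    and "(\<integral>\<^sup>+\<omega>. ennreal ((test_stat n p a b X \<omega>)\<^sup>2) \<partial>null_ext L n p lam) \<le> ennreal (1 + 2 * real p)"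
proof -
  let ?I = "{..<n} \<times> {..<p}"
  let ?N = "null_law L n p lam"
  interpret G: prob_space "gauss ?I" by (rule prob_space_gauss)
  interpret N: prob_space ?N by (rule prob_space_null_law)
  define M where "M = (\<lambda>z. gram_kernel (unit_mat n (X z)))"
  define v where "v = (\<lambda>z. \<Sum>a\<in>?I. \<Sum>b\<in>?I. M z a b * (M z a b + M z b a))"
  have meas: "(\<lambda>(z, y). wick_form ?I (M z) y) \<in> borel_measurable (obs_space n p \<Otimes>\<^sub>M mat_space n p)"
    unfolding M_def case_prod_unfold by (intro borel_measurable_gram_form) auto
  have v: "0 \<le> v z" "v z \<le> 2 * real p" for z
  proof -
    \<comment> \<open>\<open>v z\<close> is a variance, hence nonnegative, although its summands may
      be negative.\<close>
    have "0 \<le> (LINT y|gauss ?I. (wick_form ?I (M z) y)\<^sup>2)" by simp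
    then show "0 \<le> v z" by (simp add: v_def integral_wick_form_square)
    show "v z \<le> 2 * real p"
      unfolding v_def M_def by (rule sum_gram_kernel_unit_mat_le)
  qed
  have inner: "(\<integral>\<^sup>+y. ennreal ((1 + wick_form ?I (M z) y)\<^sup>2) \<partial>gauss ?I) = ennreal (1 + v z)" for z
  proof -
    note int = integrable_wick_form[of ?I "M z"] integrable_wick_form_square[of ?I "M z"]
    have "(\<integral>\<^sup>+y. ennreal ((1 + wick_form ?I (M z) y)\<^sup>2) \<partial>gauss ?I) =
        ennreal (LINT y|gauss ?I. (1 + wick_form ?I (M z) y)\<^sup>2)"
    proof (rule nn_integral_eq_integral)
      show "integrable (gauss ?I) (\<lambda>y. (1 + wick_form ?I (M z) y)\<^sup>2)"
        using int by (simp add: power2_sum)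
    qed simp
    also have "(LINT y|gauss ?I. (1 + wick_form ?I (M z) y)\<^sup>2) = 1 + v z"
      using int
      by (simp add: power2_sum integral_wick_form integral_wick_form_square v_def G.prob_space)
    finally show ?thesis .
  qed
  have ts: "test_stat n p a b X = (\<lambda>(W, Y, G). 1 + wick_form ?I (M (mix a b ?I Y W, G))
      (mix b (- a) ?I Y W))"
    by (simp add: test_stat_def M_def Let_def)
  have eq: "(\<integral>\<^sup>+\<omega>. ennreal ((test_stat n p a b X \<omega>)\<^sup>2) \<partial>null_ext L n p lam) =
      (\<integral>\<^sup>+z. ennreal (1 + v z) \<partial>?N)"
    using nn_integral_rotate_null[OF ab a, where F="\<lambda>z y. ennreal ((1 + wick_form ?I (M z) y)\<^sup>2)" and L=L
        and lam=lam and n=n and p=p] meas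
    by (simp add: inner ts case_prod_unfold)
  have "(\<integral>\<^sup>+z. 1 \<partial>?N) \<le> (\<integral>\<^sup>+z. ennreal (1 + v z) \<partial>?N)"
    using v by (intro nn_integral_mono) simp
  then show "1 \<le> (\<integral>\<^sup>+\<omega>. ennreal ((test_stat n p a b X \<omega>)\<^sup>2) \<partial>null_ext L n p lam)"
    by (simp add: eq N.emeasure_space_1)
  have "(\<integral>\<^sup>+z. ennreal (1 + v z) \<partial>?N) \<le> (\<integral>\<^sup>+z. ennreal (1 + 2 * real p) \<partial>?N)"
    using v by (intro nn_integral_mono ennreal_leI) simp
  then show "(\<integral>\<^sup>+\<omega>. ennreal ((test_stat n p a b X \<omega>)\<^sup>2) \<partial>null_ext L n p lam) \<le> ennreal (1 + 2 * real p)"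
    by (simp add: eq N.emeasure_space_1)
qed

section \<open>The planted law\<close>

text \<open>Conditioning amounts to a density proportional to the indicator of \<open>E\<close>.
  Moved to the product with \<open>N\<close>, it turns integrals under the conditioned joint law
  into weighted integrals over the unconditioned product, where the rotation is available.\<close>

lemma distr_uniform_measure_pair:
  assumes N: "prob_space N" and M: "prob_space M" and E [measurable]: "E \<in> sets M"
    and pos: "measure M E > 0" and g [measurable]: "g \<in> M \<rightarrow>\<^sub>M S"
  shows "N \<Otimes>\<^sub>M distr (uniform_measure M E) S g =
    distr (density (N \<Otimes>\<^sub>M M) (\<lambda>z. ennreal (indicator E (snd z) / measure M E)))
      (N \<Otimes>\<^sub>M S) (\<lambda>z. (fst z, g (snd z)))"
proof -
  interpret N: prob_space N by (rule N)
  interpret M: prob_space M by (rule M)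
  have em: "emeasure M E \<noteq> 0" "emeasure M E \<noteq> \<infinity>"
    using pos by (auto simp: M.emeasure_eq_measure)
  let ?U = "uniform_measure M E"
  interpret U: prob_space ?U by (rule prob_space_uniform_measure[OF em])
  have g': "g \<in> ?U \<rightarrow>\<^sub>M S" by simp
  interpret D: prob_space "distr ?U S g" by (rule U.prob_space_distr[OF g'])
  have U: "?U = density M (\<lambda>x. ennreal (indicator E x / measure M E))"
    unfolding uniform_measure_def using pos divide_ennreal[of 1 "measure M E"]
    by (intro density_cong) (auto simp: M.emeasure_eq_measure divide_ennreal split: split_indicator)
  have "N \<Otimes>\<^sub>M distr ?U S g = distr N N (\<lambda>x. x) \<Otimes>\<^sub>M distr ?U S g"
    by simp
  also have "\<dots> = distr (N \<Otimes>\<^sub>M ?U) (N \<Otimes>\<^sub>M S) (\<lambda>(x, y). (x, g y))"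
    using g' by (intro pair_measure_distr) (simp_all add: D.sigma_finite_measure_axioms)
  also have "N \<Otimes>\<^sub>M ?U = density N (\<lambda>_. 1) \<Otimes>\<^sub>M density M (\<lambda>x. ennreal (indicator E x / measure M E))"
    by (simp add: U density_1)
  also have "\<dots> = density (N \<Otimes>\<^sub>M M) (\<lambda>(x, y). 1 * ennreal (indicator E y / measure M E))"
    using U.sigma_finite_measure_axioms
    by (intro pair_measure_density) (simp_all add: U[symmetric] M.sigma_finite_measure_axioms)
  finally show ?thesis by (simp add: case_prod_unfold)
qed

section \<open>Marginals and measurability of the planted sample\<close>

lemma distr_planted_labels:
  "distr (planted L n p \<rho> lam eps) (labels_graphs_pmf L n \<rho> lam eps) fst =
    measure_pmf (labels_graphs_pmf L n \<rho> lam eps)" (is "distr ?P ?Q fst = _")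
proof (rule measure_eqI)
  interpret G: prob_space "gauss ({..<n} \<times> {..<p})" by (rule prob_space_gauss)
  interpret U: prob_space "gauss {..<p}" by (rule prob_space_gauss)
  have m: "fst \<in> ?P \<rightarrow>\<^sub>M ?Q"
    unfolding planted_def by (rule measurable_fst)
  fix A assume [measurable]: "A \<in> sets (distr ?P ?Q fst)"
  have "emeasure (distr ?P ?Q fst) A = (\<integral>\<^sup>+q. indicator A q \<partial>distr ?P ?Q fst)" by simp
  also have "\<dots> = (\<integral>\<^sup>+\<omega>. indicator A (fst \<omega>) \<partial>?P)"
    by (rule nn_integral_distr[OF m]) simp
  also have "\<dots> = (\<integral>\<^sup>+q. indicator A q \<partial>?Q)"
    using measurable_compose[OF m, of "indicator A" "borel :: ennreal measure"]
    by (subst nn_integral_planted) (auto simp: G.emeasure_space_1 U.emeasure_space_1)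
  finally show "emeasure (distr ?P ?Q fst) A = emeasure ?Q A" by simp
qed simp

lemma distr_planted_signal:
  "distr (planted L n p \<rho> lam eps) (gauss {..<p}) (\<lambda>\<omega>. fst (snd \<omega>)) = gauss {..<p}"
  (is "distr ?P ?U ?f = _")
proof (rule measure_eqI)
  interpret G: prob_space "gauss ({..<n} \<times> {..<p})" by (rule prob_space_gauss)
  have [measurable]: "?f \<in> ?P \<rightarrow>\<^sub>M ?U" by (simp add: planted_def)
  fix A assume "A \<in> sets (distr ?P ?U ?f)"
  then have [measurable]: "A \<in> sets ?U" by simp
  have "emeasure (distr ?P ?U ?f) A = (\<integral>\<^sup>+q. indicator A q \<partial>distr ?P ?U ?f)" by simp
  also have "\<dots> = (\<integral>\<^sup>+\<omega>. indicator A (?f \<omega>) \<partial>?P)" by (rule nn_integral_distr) auto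
  also have "\<dots> = (\<integral>\<^sup>+u. indicator A u \<partial>?U)"
    by (subst nn_integral_planted) (auto simp: G.emeasure_space_1 measure_pmf.emeasure_space_1)
  finally show "emeasure (distr ?P ?U ?f) A = emeasure ?U A" by simp
qed simp

text \<open>The sample space contains arbitrary real label functions; that the labels are signs is
  read off the support of the pmf and therefore holds only almost surely.\<close>

lemma AE_planted_labels:
  "AE \<omega> in planted L n p \<rho> lam eps. \<forall>i<n. fst (fst \<omega>) i = 1 \<or> fst (fst \<omega>) i = - 1"
proof (rule AE_distrD[where P="\<lambda>q. \<forall>i<n. fst q i = 1 \<or> fst q i = - 1"])
  show "fst \<in> planted L n p \<rho> lam eps \<rightarrow>\<^sub>M labels_graphs_pmf L n \<rho> lam eps"
    unfolding planted_def by (rule measurable_fst)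
  show "AE q in distr (planted L n p \<rho> lam eps) (labels_graphs_pmf L n \<rho> lam eps) fst.
      \<forall>i<n. fst q i = 1 \<or> fst q i = - 1"
    unfolding distr_planted_labels AE_measure_pmf_iff
    by (auto simp: labels_graphs_pmf_def set_Pi_pmf PiE_dflt_def)
qed

lemma borel_measurable_planted_signal:
  "k \<in> {..<p} \<Longrightarrow> (\<lambda>\<omega>. fst (snd \<omega>) k) \<in> borel_measurable (planted L n p \<rho> lam eps)"
  unfolding planted_def by measurable

lemma borel_measurable_planted_labels:
  "(\<lambda>\<omega>. fst (fst \<omega>) i) \<in> borel_measurable (planted L n p \<rho> lam eps)"
  unfolding planted_def by (rule measurable_compose[OF measurable_fst]) simp

lemma measurable_observe [measurable]: "observe n p \<mu> \<in> planted L n p \<rho> lam eps \<rightarrow>\<^sub>M obs_space n p"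
proof -
  note [measurable] = borel_measurable_planted_signal borel_measurable_planted_labels
  have [measurable]: "(\<lambda>\<omega>. snd (snd \<omega>) ij) \<in> borel_measurable (planted L n p \<rho> lam eps)"
    if "ij \<in> {..<n} \<times> {..<p}" for ij using that unfolding planted_def by measurable
  have [measurable]: "(\<lambda>\<omega>. snd (snd (fst \<omega>))) \<in> planted L n p \<rho> lam eps \<rightarrow>\<^sub>M count_space UNIV"
    unfolding planted_def by (rule measurable_compose[OF measurable_fst]) simp
  show ?thesis
    unfolding observe_def obs_space_def mat_space_def case_prod_unfold
    by (intro measurable_Pair measurable_restrict) (auto intro!: borel_measurable_add borel_measurable_times)
qed

section \<open>Concentration of the signal energy\<close>

definition energy :: "nat \<Rightarrow> sample \<Rightarrow> real" where
  "energy p \<omega> = (\<Sum>k<p. (fst (snd \<omega>) k)\<^sup>2)"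

lemma borel_measurable_energy [measurable]: "energy p \<in> borel_measurable (planted L n p \<rho> lam eps)"
  unfolding energy_def
  by (intro borel_measurable_sum borel_measurable_power) (simp add: borel_measurable_planted_signal)

lemma truncation_event_iff:
  "\<omega> \<in> truncation_event p \<iota> \<longleftrightarrow> (1 - \<iota>) * real p \<le> energy p \<omega> \<and> energy p \<omega> \<le> (1 + \<iota>) * real p"
  by (auto simp: truncation_event_def energy_def case_prod_unfold)

lemma truncation_event_Int_space [measurable]:
  "truncation_event p \<iota> \<inter> space (planted L n p \<rho> lam eps) \<in> sets (planted L n p \<rho> lam eps)"
proof -
  have "truncation_event p \<iota> \<inter> space (planted L n p \<rho> lam eps) =
    {\<omega> \<in> space (planted L n p \<rho> lam eps).
      (1 - \<iota>) * real p \<le> energy p \<omega> \<and> energy p \<omega> \<le> (1 + \<iota>) * real p}"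
    by (auto simp: truncation_event_iff)
  also have "\<dots> \<in> sets (planted L n p \<rho> lam eps)" by measurable
  finally show ?thesis .
qed

text \<open>The deviation \<open>energy p \<omega> - p\<close> is the Wick form of the identity
  kernel in \<open>u\<close>. Its variance is \<open>2 * p\<close>, so its mean absolute value is of
  order \<open>sqrt p\<close>.\<close>

lemma energy_deviation:
  assumes "p > 0"
  shows "integrable (planted L n p \<rho> lam eps) (\<lambda>\<omega>. \<bar>energy p \<omega> - p\<bar>)"
    and "(LINT \<omega>|planted L n p \<rho> lam eps. \<bar>energy p \<omega> - p\<bar>) \<le> 3 / 2 * sqrt p"
proof -
  let ?P = "planted L n p \<rho> lam eps" and ?U = "gauss {..<p}"
  interpret P: prob_space ?P by (rule prob_space_planted)
  define w where "w = wick_form {..<p} (\<lambda>a b. of_bool (a = b))"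
  have w_eq: "w u = (\<Sum>k<p. (u k)\<^sup>2) - p" for u
  proof -
    have "w u = (\<Sum>k<p. \<Sum>l<p. if l = k then (u k)\<^sup>2 - 1 else 0)"
      unfolding w_def wick_form_def by (intro sum.cong) (auto simp: power2_eq_square)
    then show ?thesis by (simp add: sum_subtractf)
  qed
  have w_energy: "energy p \<omega> - p = w (fst (snd \<omega>))" for \<omega>
    by (simp add: w_eq energy_def)
  have f [measurable]: "(\<lambda>\<omega>. fst (snd \<omega>)) \<in> ?P \<rightarrow>\<^sub>M ?U" by (simp add: planted_def)
  have int_w2: "integrable ?U (\<lambda>u. (w u)\<^sup>2)"
    unfolding w_def by (rule integrable_wick_form_square) simp
  have [measurable]: "(\<lambda>u. (w u)\<^sup>2) \<in> borel_measurable ?U"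
    using int_w2 by (rule borel_measurable_integrable)
  have val_w2: "(LINT u|?U. (w u)\<^sup>2) = 2 * p"
  proof -
    have "(LINT u|?U. (w u)\<^sup>2) = (\<Sum>a<p. \<Sum>b<p. if b = a then 2 else 0)"
      unfolding w_def by (subst integral_wick_form_square) (auto intro!: sum.cong)
    then show ?thesis by simp
  qed
  have int2: "integrable ?P (\<lambda>\<omega>. (energy p \<omega> - p)\<^sup>2)"
    unfolding w_energy using int_w2 integrable_distr_eq[OF f, of "\<lambda>u. (w u)\<^sup>2"]
    by (simp add: distr_planted_signal)
  have val2: "(LINT \<omega>|?P. (energy p \<omega> - p)\<^sup>2) = 2 * p"
    unfolding w_energy val_w2[symmetric] using integral_distr[OF f, of "\<lambda>u. (w u)\<^sup>2"]
    by (simp add: distr_planted_signal)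
  \<comment> \<open>The arithmetic-geometric mean inequality for \<open>sqrt p\<close> and
    \<open>\<bar>t\<bar>\<close>. On average the square contributes \<open>sqrt p\<close> and the
    constant \<open>sqrt p / 2\<close>, which gives the factor \<open>3 / 2\<close>.\<close>
  have le: "\<bar>t\<bar> \<le> 1 / (2 * sqrt p) * t\<^sup>2 + sqrt p / 2" for t :: real
  proof -
    have "2 * sqrt p * \<bar>t\<bar> \<le> t\<^sup>2 + p"
      using sum_squares_bound[of "sqrt p" "\<bar>t\<bar>"] by simp
    then have "\<bar>t\<bar> \<le> (t\<^sup>2 + p) / (2 * sqrt p)"
      using assms by (simp add: pos_le_divide_eq mult_ac)
    also have "\<dots> = 1 / (2 * sqrt p) * t\<^sup>2 + sqrt p / 2"
      using assms by (simp add: add_divide_distrib real_div_sqrt)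
    finally show ?thesis .
  qed
  have dom: "integrable ?P (\<lambda>\<omega>. 1 / (2 * sqrt p) * (energy p \<omega> - p)\<^sup>2 + sqrt p / 2)"
    using int2 by simp
  show int: "integrable ?P (\<lambda>\<omega>. \<bar>energy p \<omega> - p\<bar>)"
    using le by (intro Bochner_Integration.integrable_bound[OF dom])
      (auto intro!: AE_I2 order_trans[OF le] simp del: real_sqrt_eq_iff)
  have "(LINT \<omega>|?P. \<bar>energy p \<omega> - p\<bar>) \<le>
      (LINT \<omega>|?P. 1 / (2 * sqrt p) * (energy p \<omega> - p)\<^sup>2 + sqrt p / 2)"
    by (rule integral_mono[OF int dom le])
  also have "\<dots> = 1 / (2 * sqrt p) * (2 * p) + sqrt p / 2"
    using int2 by (simp add: val2 P.prob_space)
  also have "\<dots> = 3 / 2 * sqrt p"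
    using assms by (simp add: real_div_sqrt)
  finally show "(LINT \<omega>|?P. \<bar>energy p \<omega> - p\<bar>) \<le> 3 / 2 * sqrt p" .
qed

section \<open>Alignment of the estimate with the labels\<close>

definition label_score ::
  "nat \<Rightarrow> nat \<Rightarrow> real \<Rightarrow> (observation \<Rightarrow> nat \<times> nat \<Rightarrow> real) \<Rightarrow> sample \<Rightarrow> real" where
  "label_score n p \<mu> X \<omega> =
     frob_inner n (unit_mat n (X (observe n p \<mu> \<omega>))) (outer (fst (fst \<omega>)))"

lemma borel_measurable_label_score:
  assumes X [measurable]: "X \<in> obs_space n p \<rightarrow>\<^sub>M mat_space n n"
  shows "label_score n p \<mu> X \<in> borel_measurable (planted L n p \<rho> lam eps)"
proof -
  note [measurable] = borel_measurable_planted_labels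
  have [measurable]: "(\<lambda>\<omega>. unit_mat n (X (observe n p \<mu> \<omega>)) (i, j)) \<in> borel_measurable (planted L n p \<rho> lam eps)"
    if "i \<in> {..<n}" "j \<in> {..<n}" for i j
    using that by (intro borel_measurable_unit_mat measurable_compose[OF measurable_observe X]) auto
  show ?thesis
    unfolding label_score_def frob_inner_def outer_def case_prod_conv by measurable
qed

lemma frob_norm_outer:
  assumes "\<forall>i<n. x i = 1 \<or> x i = - 1"
  shows "frob_norm n (outer x) = real n"
proof -
  have "(x i)\<^sup>2 = 1" if "i < n" for i using assms that by auto
  then have "frob_inner n (outer x) (outer x) = (real n)\<^sup>2"
    by (simp add: frob_inner_self outer_def power_mult_distrib power2_eq_square[of "real n"])
  then show ?thesis by (simp add: frob_norm_def)
qed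

lemma abs_label_score_le:
  assumes "\<forall>i<n. fst (fst \<omega>) i = 1 \<or> fst (fst \<omega>) i = - 1"
  shows "\<bar>label_score n p \<mu> X \<omega>\<bar> \<le> real n"
proof -
  let ?A = "unit_mat n (X (observe n p \<mu> \<omega>))"
  have "frob_norm n ?A \<le> 1"
    using frob_inner_unit_mat_self[of n "X (observe n p \<mu> \<omega>)"] by (simp add: frob_norm_def)
  then have "frob_norm n ?A * real n \<le> 1 * real n" by (intro mult_right_mono) auto
  then show ?thesis
    using frob_cauchy_schwarz[of n ?A "outer (fst (fst \<omega>))"] frob_norm_outer[OF assms]
    by (simp add: label_score_def)
qed

text \<open>As \<open>a * sqrt \<mu>' = sqrt \<mu>\<close>, the rotation turns an observation of
  strength \<mu>' and the noise \<open>W\<close> into an observation of strength \<mu> and a second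
  array with independent noise \<open>y\<close>. Averaging over \<open>y\<close> first leaves the
  energy times the label score. The indicator of \<open>E\<close> stands for the truncation, still
  without dividing by its probability.\<close>

lemma
  fixes a b \<rho> \<iota> \<mu> \<mu>' :: real and L n p :: nat and lam eps :: "nat \<Rightarrow> real"
  assumes X [measurable]: "X \<in> obs_space n p \<rightarrow>\<^sub>M mat_space n n"
    and ab: "a\<^sup>2 + b\<^sup>2 = 1" and a: "a > 0" and \<iota>: "\<iota> > 0" and n: "n > 0"
    and \<mu>: "\<mu> \<ge> 0" "\<mu>' \<ge> 0" "a * sqrt \<mu>' = sqrt \<mu>"
  defines "P \<equiv> planted L n p \<rho> lam eps" and "E \<equiv> truncation_event p \<iota> \<inter> space (planted L n p \<rho> lam eps)"
    and "G \<equiv> gauss ({..<n} \<times> {..<p})"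
  shows integrable_planted_test_stat: "integrable (G \<Otimes>\<^sub>M P)
        (\<lambda>(W, \<omega>). indicator E \<omega> * test_stat n p a b X (W, observe n p \<mu>' \<omega>))" (is ?int)
    and integrable_truncated_score: "integrable P (\<lambda>\<omega>. indicator E \<omega> * (energy p \<omega> * label_score n p \<mu> X \<omega>))"
      (is ?ints)
    and integral_planted_test_stat: "(LINT z|(G \<Otimes>\<^sub>M P). (case z of (W, \<omega>) \<Rightarrow>
        indicator E \<omega> * test_stat n p a b X (W, observe n p \<mu>' \<omega>))) =
      measure P E + b\<^sup>2 * \<mu>' / n * (LINT \<omega>|P. indicator E \<omega> * (energy p \<omega> * label_score n p \<mu> X \<omega>))"
      (is ?val)
proof -
  let ?I = "{..<n} \<times> {..<p}"
  interpret G: prob_space G unfolding G_def by (rule prob_space_gauss)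
  interpret P: prob_space P unfolding P_def by (rule prob_space_planted)
  interpret GP: pair_prob_space G P ..
  interpret PG: pair_prob_space P G ..
  note [measurable] = borel_measurable_label_score[OF X]
  have E [measurable]: "E \<in> sets P" unfolding E_def P_def by simp
  have obs [measurable]: "observe n p \<mu> \<in> P \<rightarrow>\<^sub>M obs_space n p" for \<mu>
    unfolding P_def by simp
  have sc [measurable]: "label_score n p \<mu> X \<in> borel_measurable P" "energy p \<in> borel_measurable P"
    unfolding P_def by simp_all
  define T where "T = (\<lambda>(W :: nat \<times> nat \<Rightarrow> real, (q :: (nat \<Rightarrow> real) \<times> (nat \<Rightarrow> nat \<Rightarrow> real) \<times> graphs,
    u :: nat \<Rightarrow> real, Z)). ((q, u, mix a b ?I Z W), mix b (- a) ?I Z W))"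
  have T [measurable]: "T \<in> G \<Otimes>\<^sub>M P \<rightarrow>\<^sub>M P \<Otimes>\<^sub>M G" and dT: "distr (G \<Otimes>\<^sub>M P) (P \<Otimes>\<^sub>M G) T = P \<Otimes>\<^sub>M G"
    using distr_rotate_planted[OF ab a, of n p L \<rho> lam eps] by (simp_all add: T_def G_def P_def)
  \<comment> \<open>The coefficient of the signal that remains in the second array.\<close>
  define s where "s = b * sqrt (\<mu>' / n)"
  define m where "m = (\<lambda>\<omega> :: sample. \<lambda>(i, k). s * fst (fst \<omega>) i * fst (snd \<omega>) k)"
  define M where "M = (\<lambda>\<omega>. gram_kernel (unit_mat n (X (observe n p \<mu> \<omega>))))"
  \<comment> \<open>The statistic in the new variables: \<open>M \<omega>\<close> is computed from
    an observation of strength \<mu>, while \<open>m \<omega>\<close> and \<open>y\<close> are the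
    signal and the noise of the second array.\<close>
  define H where "H = (\<lambda>(\<omega>, y). indicator E \<omega> * (1 + wick_form ?I (M \<omega>) (\<lambda>i. m \<omega> i + y i)))"
  have s2: "s\<^sup>2 = b\<^sup>2 * \<mu>' / n" using \<mu> by (simp add: s_def power_mult_distrib)
  have H_T: "(case z of (W, \<omega>) \<Rightarrow> indicator E \<omega> * test_stat n p a b X (W, observe n p \<mu>' \<omega>)) = H (T z)"
    if z: "z \<in> space (G \<Otimes>\<^sub>M P)" for z
  proof -
    obtain W x g l u Z where z_eq: "z = (W, ((x, l, g), u, Z))" by (cases z) auto
    \<comment> \<open>The truncation event depends on \<open>u\<close> alone, which the rotation
      leaves fixed.\<close>
    have Esnd: "((x, l, g), u, mix a b ?I Z W) \<in> E \<longleftrightarrow> ((x, l, g), u, Z) \<in> E"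
    proof -
      have "((x, l, g), u, Z) \<in> space P" using z by (simp add: z_eq space_pair_measure)
      moreover have "((x, l, g), u, mix a b ?I Z W) \<in> space P"
        using measurable_space[OF T z] by (simp add: z_eq T_def space_pair_measure)
      ultimately show ?thesis by (simp add: E_def P_def truncation_event_iff energy_def)
    qed
    have "a * sqrt (\<mu>' / n) = sqrt (\<mu> / n)"
      using \<mu>(3) by (simp add: real_sqrt_divide)
    then have o1: "mix a b ?I (fst (observe n p \<mu>' ((x, l, g), u, Z))) W =
        fst (observe n p \<mu> ((x, l, g), u, mix a b ?I Z W))"
      by (auto simp: mix_def observe_def fun_eq_iff restrict_def algebra_simps)
    have o2: "mix b (- a) ?I (fst (observe n p \<mu>' ((x, l, g), u, Z))) W i =
        m ((x, l, g), u, mix a b ?I Z W) i + mix b (- a) ?I Z W i" if "i \<in> ?I" for i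
      using that by (auto simp: mix_def observe_def m_def s_def algebra_simps)
    have o3: "snd (observe n p c ((x, l, g), u, z)) = g" for c z by (simp add: observe_def)
    have o4: "(fst (observe n p c ((x, l, g), u, z)), g) = observe n p c ((x, l, g), u, z)" for c z
      by (simp add: observe_def)
    have "test_stat n p a b X (W, observe n p \<mu>' ((x, l, g), u, Z)) =
      1 + wick_form ?I (M ((x, l, g), u, mix a b ?I Z W))
        (\<lambda>i. m ((x, l, g), u, mix a b ?I Z W) i + mix b (- a) ?I Z W i)"
    proof -
      have "test_stat n p a b X (W, observe n p \<mu>' ((x, l, g), u, Z)) =
        1 + wick_form ?I (gram_kernel (unit_mat n (X (mix a b ?I (fst (observe n p \<mu>' ((x, l, g), u, Z))) W,
          snd (observe n p \<mu>' ((x, l, g), u, Z)))))) (mix b (- a) ?I (fst (observe n p \<mu>' ((x, l, g), u, Z))) W)"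
        by (simp add: test_stat_def Let_def case_prod_unfold)
      also have "\<dots> = 1 + wick_form ?I (M ((x, l, g), u, mix a b ?I Z W))
          (mix b (- a) ?I (fst (observe n p \<mu>' ((x, l, g), u, Z))) W)"
        unfolding o1 o3 o4 M_def ..
      finally show ?thesis using wick_form_cong[OF o2] by simp
    qed
    then show ?thesis by (simp add: z_eq T_def H_def Esnd indicator_def)
  qed
  have H_meas [measurable]: "H \<in> borel_measurable (P \<Otimes>\<^sub>M G)"
  proof -
    \<comment> \<open>Restricting the shifted array to the index set makes it a point of
      \<open>mat_space\<close>; the form does not see the restriction.\<close>
    have "(\<lambda>z. \<lambda>i\<in>?I. m (fst z) i + snd z i) \<in> P \<Otimes>\<^sub>M G \<rightarrow>\<^sub>M mat_space n p"
      unfolding mat_space_def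
    proof (rule measurable_restrict)
      fix i assume "i \<in> ?I"
      then obtain j k where i: "i = (j, k)" "k \<in> {..<p}" "(j, k) \<in> ?I" by auto
      note [measurable] = borel_measurable_planted_labels[of j L n p \<rho> lam eps, folded P_def]
        borel_measurable_planted_signal[OF i(2), of L n \<rho> lam eps, folded P_def]
      have [measurable]: "(\<lambda>y. y (j, k)) \<in> borel_measurable G"
        unfolding G_def using i by measurable
      show "(\<lambda>z. m (fst z) i + snd z i) \<in> borel_measurable (P \<Otimes>\<^sub>M G)"
        unfolding m_def i(1) case_prod_conv by measurable
    qed
    then have "(\<lambda>z. wick_form ?I (M (fst z)) (\<lambda>i\<in>?I. m (fst z) i + snd z i)) \<in> borel_measurable (P \<Otimes>\<^sub>M G)"
      unfolding M_def by (intro borel_measurable_gram_form) measurable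
    moreover have "wick_form ?I (M (fst z)) (\<lambda>i\<in>?I. m (fst z) i + snd z i) =
        wick_form ?I (M (fst z)) (\<lambda>i. m (fst z) i + snd z i)" for z
      by (rule wick_form_cong) simp
    ultimately show ?thesis unfolding H_def case_prod_unfold by simp
  qed
  \<comment> \<open>On the event each \<open>(u k)\<^sup>2\<close> is at most the energy, hence at
    most \<open>(1 + \<iota>) * p\<close>, so \<open>K\<close> bounds the squared means. This makes
    \<open>D\<close> a majorant of \<open>H\<close> that does not depend on the sample.\<close>
  define K where "K = s\<^sup>2 * ((1 + \<iota>) * p)"
  define D where "D = (\<lambda>y. 1 + (\<Sum>a\<in>?I. \<Sum>b\<in>?I. 1 + 2 * K + y a * y a + y b * (y b :: real)))"
  have K0: "K \<ge> 0" using \<iota> by (simp add: K_def)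
  have D0: "D y \<ge> 0" for y
    unfolding D_def using K0 by (intro add_nonneg_nonneg sum_nonneg) auto
  have D_int: "integrable G D"
    unfolding D_def G_def
    by (intro Bochner_Integration.integrable_add Bochner_Integration.integrable_sum
        integrable_gauss_quadratic) (auto simp: G.integrable_const G_def[symmetric])
  have H_int: "integrable G (\<lambda>y. H (\<omega>, y))" for \<omega>
    unfolding H_def case_prod_conv G_def
    by (intro integrable_mult_right Bochner_Integration.integrable_add integrable_wick_form_shift)
      (simp_all add: G_def[symmetric])
  have H_le: "\<bar>H (\<omega>, y)\<bar> \<le> D y" if lab: "\<forall>i<n. fst (fst \<omega>) i = 1 \<or> fst (fst \<omega>) i = - 1" for \<omega> y
  proof (cases "\<omega> \<in> E")
    case False
    then show ?thesis using D0 by (simp add: H_def)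
  next
    case True
    have "(m \<omega> i)\<^sup>2 \<le> K" if iI: "i \<in> ?I" for i
    proof -
      obtain j k where i: "i = (j, k)" "j < n" "k < p" using iI by auto
      have "(fst (snd \<omega>) k)\<^sup>2 \<le> energy p \<omega>"
        unfolding energy_def using i by (intro member_le_sum) auto
      also have "\<dots> \<le> (1 + \<iota>) * p" using True by (simp add: E_def truncation_event_iff)
      finally have "s\<^sup>2 * (fst (snd \<omega>) k)\<^sup>2 \<le> K"
        unfolding K_def by (rule mult_left_mono) simp
      moreover have "(fst (fst \<omega>) j)\<^sup>2 = 1" using lab i by auto
      ultimately show ?thesis by (simp add: i m_def power_mult_distrib)
    qed
    then have "\<bar>wick_form ?I (M \<omega>) (\<lambda>i. m \<omega> i + y i)\<bar> \<le>
        (\<Sum>a\<in>?I. \<Sum>b\<in>?I. 1 + 2 * K + y a * y a + y b * y b)"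
      by (intro abs_wick_form_shift_le) (auto simp: M_def gram_kernel_def abs_mult intro: abs_unit_mat_le)
    then show ?thesis using True by (simp add: H_def D_def)
  qed
  have AE_lab: "AE \<omega> in P. \<forall>i<n. fst (fst \<omega>) i = 1 \<or> fst (fst \<omega>) i = - 1"
    unfolding P_def by (rule AE_planted_labels)
  have H_PG: "integrable (P \<Otimes>\<^sub>M G) H"
  \<comment> \<open>The inner integral of the norm is bounded, almost surely in the sample, by the
    mean of \<open>D\<close>.\<close>
  proof (rule PG.Fubini_integrable)
    show "integrable P (\<lambda>\<omega>. LINT y|G. norm (H (\<omega>, y)))"
    proof (rule P.integrable_const_bound)
      show "AE \<omega> in P. norm (LINT y|G. norm (H (\<omega>, y))) \<le> (LINT y|G. D y)"
        using AE_lab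
      proof eventually_elim
        case (elim \<omega>)
        have "(LINT y|G. norm (H (\<omega>, y))) \<le> (LINT y|G. D y)"
          using H_int D_int H_le[OF elim] by (intro integral_mono) auto
        then show ?case by simp
      qed
    qed measurable
  qed (use H_int in auto)
  then have "integrable (G \<Otimes>\<^sub>M P) (\<lambda>z. H (T z))"
    using integrable_distr_eq[OF T, of H] dT by simp
  then show ?int
    by (subst Bochner_Integration.integrable_cong[OF refl H_T])
  have inner: "(LINT y|G. H (\<omega>, y)) =
      indicator E \<omega> + s\<^sup>2 * (indicator E \<omega> * (energy p \<omega> * label_score n p \<mu> X \<omega>))" for \<omega>
  proof -
    have "(LINT y|G. H (\<omega>, y)) = indicator E \<omega> * (1 + (\<Sum>a\<in>?I. \<Sum>b\<in>?I. M \<omega> a b * (m \<omega> a * m \<omega> b)))"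
      unfolding H_def case_prod_conv
      using integrable_wick_form_shift[of ?I "M \<omega>" "m \<omega>", folded G_def]
        integral_wick_form_shift[of ?I "M \<omega>" "m \<omega>", folded G_def]
      by (simp add: G.prob_space)
    \<comment> \<open>The kernel ties the column indices together, so the rank-one mean splits into
      \<open>\<Sum>k<p. (u k)\<^sup>2\<close> and the product of the normalised estimate with
      \<open>outer x\<close>.\<close>
    also have "(\<Sum>a\<in>?I. \<Sum>b\<in>?I. M \<omega> a b * (m \<omega> a * m \<omega> b)) = s\<^sup>2 * (energy p \<omega> * label_score n p \<mu> X \<omega>)"
      unfolding M_def sum_gram_kernel
      by (simp add: m_def label_score_def frob_inner_def outer_def energy_def
          sum_distrib_left sum_distrib_right power2_eq_square mult_ac)
    finally show ?thesis by (simp add: algebra_simps)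
  qed
  show ints: ?ints
  proof (rule P.integrable_const_bound)
    show "AE \<omega> in P. norm (indicator E \<omega> * (energy p \<omega> * label_score n p \<mu> X \<omega>)) \<le> (1 + \<iota>) * p * n"
      using AE_lab
    proof eventually_elim
      case (elim \<omega>)
      show ?case
      proof (cases "\<omega> \<in> E")
        case True
        have "energy p \<omega> \<ge> 0" by (simp add: energy_def sum_nonneg)
        moreover have "energy p \<omega> \<le> (1 + \<iota>) * p" using True by (simp add: E_def truncation_event_iff)
        ultimately show ?thesis
          using True abs_label_score_le[OF elim, of p \<mu> X] \<iota> by (simp add: abs_mult mult_mono)
      qed (use \<iota> in simp)
    qed
  qed measurable
  have "(LINT z|(G \<Otimes>\<^sub>M P). (case z of (W, \<omega>) \<Rightarrow>
        indicator E \<omega> * test_stat n p a b X (W, observe n p \<mu>' \<omega>))) = (LINT z|(G \<Otimes>\<^sub>M P). H (T z))"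
    by (rule Bochner_Integration.integral_cong[OF refl H_T])
  also have "\<dots> = (LINT z|(P \<Otimes>\<^sub>M G). H z)"
    using integral_distr[OF T, of H] dT by simp
  also have "\<dots> = (LINT \<omega>|P. LINT y|G. H (\<omega>, y))"
    using PG.integral_fst'[OF H_PG] by simp
  also have "\<dots> = measure P E + s\<^sup>2 * (LINT \<omega>|P. indicator E \<omega> * (energy p \<omega> * label_score n p \<mu> X \<omega>))"
    unfolding inner using ints sets.Int_space_eq2[OF E]
    by (subst Bochner_Integration.integral_add) (simp_all add: P.emeasure_eq_measure)
  finally show ?val by (simp add: s2)
qed

text \<open>
  Replacing \<open>energy\<close> by \<open>p\<close> costs at most \<open>n \<bar>energy - p\<bar> / \<iota>\<close> pointwise: on the event because the
  score is at most \<open>n\<close>, off it because there \<open>\<bar>energy - p\<bar> > \<iota> p\<close>.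
\<close>

lemma truncated_score_ge:
  fixes \<iota> \<mu> \<rho> :: real and L n p :: nat and lam eps :: "nat \<Rightarrow> real"
  assumes X [measurable]: "X \<in> obs_space n p \<rightarrow>\<^sub>M mat_space n n"
    and \<iota>: "0 < \<iota>" "\<iota> < 1" and n: "n > 0" and p: "p > 0"
  defines "P \<equiv> planted L n p \<rho> lam eps" and "E \<equiv> truncation_event p \<iota> \<inter> space (planted L n p \<rho> lam eps)"
  assumes int: "integrable P (\<lambda>\<omega>. indicator E \<omega> * (energy p \<omega> * label_score n p \<mu> X \<omega>))"
  shows "n * (p * overlap L n p \<mu> \<rho> lam eps X - 3 / 2 * sqrt p / \<iota>) \<le>
    (LINT \<omega>|P. indicator E \<omega> * (energy p \<omega> * label_score n p \<mu> X \<omega>))"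
proof -
  interpret P: prob_space P unfolding P_def by (rule prob_space_planted)
  let ?sc = "label_score n p \<mu> X"
  have [measurable]: "?sc \<in> borel_measurable P"
    unfolding P_def by (rule borel_measurable_label_score[OF X])
  note [measurable] = borel_measurable_planted_labels[of _ L n p \<rho> lam eps, folded P_def]
  have AE_lab: "AE \<omega> in P. \<forall>i<n. fst (fst \<omega>) i = 1 \<or> fst (fst \<omega>) i = - 1"
    unfolding P_def by (rule AE_planted_labels)
  have int_sc: "integrable P ?sc"
    using AE_lab by (intro P.integrable_const_bound[where B="real n"])
      (auto elim!: eventually_mono simp: abs_label_score_le)
  note dev = energy_deviation[OF p, of L n \<rho> lam eps, folded P_def]
  have "overlap L n p \<mu> \<rho> lam eps X = (LINT \<omega>|P. ?sc \<omega> / frob_norm n (outer (fst (fst \<omega>))))"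
    by (simp add: overlap_def P_def Let_def label_score_def frob_inner_unit_mat)
  \<comment> \<open>For sign labels \<open>outer x\<close> has norm \<open>n\<close>, so this
    normalisation is constant almost surely.\<close>
  also have "\<dots> = (LINT \<omega>|P. ?sc \<omega> / n)"
  proof (rule integral_cong_AE)
    show "(\<lambda>\<omega>. ?sc \<omega> / frob_norm n (outer (fst (fst \<omega>)))) \<in> borel_measurable P"
      unfolding frob_norm_def frob_inner_def outer_def case_prod_conv by measurable
    show "AE \<omega> in P. ?sc \<omega> / frob_norm n (outer (fst (fst \<omega>))) = ?sc \<omega> / n"
      using AE_lab by eventually_elim (simp add: frob_norm_outer)
  qed measurable
  finally have ov: "(LINT \<omega>|P. ?sc \<omega>) = n * overlap L n p \<mu> \<rho> lam eps X"
    using n by simp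
  have "n * (p * overlap L n p \<mu> \<rho> lam eps X - 3 / 2 * sqrt p / \<iota>) \<le>
      p * (LINT \<omega>|P. ?sc \<omega>) - n / \<iota> * (LINT \<omega>|P. \<bar>energy p \<omega> - p\<bar>)"
  proof -
    have "n / \<iota> * (LINT \<omega>|P. \<bar>energy p \<omega> - p\<bar>) \<le> n / \<iota> * (3 / 2 * sqrt p)"
      using dev(2) \<iota> by (intro mult_left_mono) auto
    moreover have "n * (p * overlap L n p \<mu> \<rho> lam eps X - 3 / 2 * sqrt p / \<iota>) =
        p * (n * overlap L n p \<mu> \<rho> lam eps X) - n / \<iota> * (3 / 2 * sqrt p)"
      by (simp add: right_diff_distrib)
    ultimately show ?thesis unfolding ov by linarith
  qed
  also have "\<dots> = (LINT \<omega>|P. p * ?sc \<omega> - n / \<iota> * \<bar>energy p \<omega> - p\<bar>)"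
    using int_sc dev(1) by simp
  also have "\<dots> \<le> (LINT \<omega>|P. indicator E \<omega> * (energy p \<omega> * ?sc \<omega>))"
  proof (rule integral_mono_AE)
    show "integrable P (\<lambda>\<omega>. p * ?sc \<omega> - n / \<iota> * \<bar>energy p \<omega> - p\<bar>)"
      using int_sc dev(1) by simp
    show "AE \<omega> in P. p * ?sc \<omega> - n / \<iota> * \<bar>energy p \<omega> - p\<bar> \<le> indicator E \<omega> * (energy p \<omega> * ?sc \<omega>)"
      using AE_lab AE_space
    proof eventually_elim
      case (elim \<omega>)
      let ?d = "\<bar>energy p \<omega> - p\<bar>"
      have sc: "\<bar>?sc \<omega>\<bar> \<le> n" by (rule abs_label_score_le[OF elim(1)])
      \<comment> \<open>Since \<iota> < 1, the error term with factor \<open>n / \<iota>\<close>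
        needed off the event also covers the error \<open>n * ?d\<close> on it.\<close>
      have d: "n * ?d \<le> n / \<iota> * ?d"
        using \<iota> by (intro mult_right_mono) (auto simp: pos_le_divide_eq mult_left_le)
      show ?case
      proof (cases "\<omega> \<in> E")
        case True
        have "(p - energy p \<omega>) * ?sc \<omega> \<le> \<bar>(p - energy p \<omega>) * ?sc \<omega>\<bar>"
          by (rule abs_ge_self)
        also have "\<dots> \<le> ?d * n"
          using mult_left_mono[OF sc, of ?d] by (simp add: abs_mult abs_minus_commute)
        finally have "(p - energy p \<omega>) * ?sc \<omega> \<le> ?d * n" .
        then have "p * ?sc \<omega> \<le> energy p \<omega> * ?sc \<omega> + n * ?d"
          unfolding left_diff_distrib by (simp add: mult.commute[of "real n"])
        then show ?thesis using True d by simp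
      next
        case False
        then have "\<iota> * p \<le> ?d"
          using elim(2) by (auto simp: E_def P_def truncation_event_iff algebra_simps)
        then have "n / \<iota> * (\<iota> * p) \<le> n / \<iota> * ?d"
          using \<iota> by (intro mult_left_mono) auto
        moreover have "p * ?sc \<omega> \<le> p * real n"
          using sc by (intro mult_left_mono) auto
        ultimately show ?thesis using False \<iota> by (simp add: mult.commute)
      qed
    qed
  qed (rule int)
  finally show ?thesis .
qed

text \<open>Combines the planted mean with the null second moment, which is at most
  \<open>1 + 2 * p\<close>. A positive lower bound for the truncated score also forces the
  truncation event to have positive probability, so \<open>m > 0\<close> is part of the second
  conclusion.\<close>

lemma Adv_test_stat_ge:
  fixes a b \<rho> \<iota> \<mu> \<mu>' :: real and L n p :: nat and lam eps :: "nat \<Rightarrow> real"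
  assumes X [measurable]: "X \<in> obs_space n p \<rightarrow>\<^sub>M mat_space n n"
    and ab: "a\<^sup>2 + b\<^sup>2 = 1" and a: "a > 0" and \<iota>: "0 < \<iota>" "\<iota> < 1" and n: "n > 0" and p: "p > 0"
    and \<mu>: "\<mu> \<ge> 0" "\<mu>' \<ge> 0" "a * sqrt \<mu>' = sqrt \<mu>"
  defines "m \<equiv> measure (planted L n p \<rho> lam eps) (truncation_event p \<iota> \<inter> space (planted L n p \<rho> lam eps))"
  shows "m > 0 \<Longrightarrow> test_function L n p \<mu>' \<rho> lam eps \<iota> (test_stat n p a b X)"
    and "p * overlap L n p \<mu> \<rho> lam eps X - 3 / 2 * sqrt p / \<iota> > 0 \<Longrightarrow> m > 0 \<and>
      b\<^sup>2 * \<mu>' * (p * overlap L n p \<mu> \<rho> lam eps X - 3 / 2 * sqrt p / \<iota>) / sqrt (1 + 2 * real p) \<le>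
        Adv L n p \<mu>' \<rho> lam eps \<iota> (test_stat n p a b X)"
proof -
  let ?P = "planted L n p \<rho> lam eps" and ?G = "gauss ({..<n} \<times> {..<p})"
  let ?E = "truncation_event p \<iota> \<inter> space ?P"
  let ?f = "test_stat n p a b X" and ?K = "p * overlap L n p \<mu> \<rho> lam eps X - 3 / 2 * sqrt p / \<iota>"
  let ?S = "LINT \<omega>|?P. indicator ?E \<omega> * (energy p \<omega> * label_score n p \<mu> X \<omega>)"
  interpret P: prob_space ?P by (rule prob_space_planted)
  note facts = integrable_planted_test_stat[OF X ab a \<iota>(1) n \<mu>, of L \<rho> lam eps]
    integral_planted_test_stat[OF X ab a \<iota>(1) n \<mu>, of L \<rho> lam eps]
  note ints = integrable_truncated_score[OF X ab a \<iota>(1) n \<mu>, of L \<rho> lam eps]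
  have S_ge: "n * ?K \<le> ?S" by (rule truncated_score_ge[OF X \<iota> n p ints])
  have f_meas: "?f \<in> borel_measurable (mat_space n p \<Otimes>\<^sub>M obs_space n p)"
    by (rule borel_measurable_test_stat[OF X])
  have f_meas_null: "?f \<in> borel_measurable (null_ext L n p lam)"
    using f_meas unfolding null_ext_def
    by (simp cong: measurable_cong_sets add: sets_pair_measure_cong[OF sets_gauss sets_null_law] mat_space_def)
  have f_meas': "?f \<in> borel_measurable (?G \<Otimes>\<^sub>M obs_space n p)"
    using f_meas
    by (simp cong: measurable_cong_sets add: sets_pair_measure_cong[OF sets_gauss refl] mat_space_def)
  have map_meas: "(\<lambda>z. (fst z, observe n p \<mu>' (snd z))) \<in> ?G \<Otimes>\<^sub>M ?P \<rightarrow>\<^sub>M ?G \<Otimes>\<^sub>M obs_space n p"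
    by measurable
  have null: "1 \<le> (\<integral>\<^sup>+\<omega>. ennreal ((?f \<omega>)\<^sup>2) \<partial>null_ext L n p lam)"
    "(\<integral>\<^sup>+\<omega>. ennreal ((?f \<omega>)\<^sup>2) \<partial>null_ext L n p lam) \<le> ennreal (1 + 2 * real p)"
    by (rule nn_integral_null_test_stat[OF X ab a])+
  have null_int: "integrable (null_ext L n p lam) (\<lambda>\<omega>. (?f \<omega>)\<^sup>2)"
    using f_meas_null le_less_trans[OF null(2)] by (intro integrableI_bounded) (auto simp: less_top)
  define V where "V = (LINT \<omega>|null_ext L n p lam. (?f \<omega>)\<^sup>2)"
  have "ennreal V = (\<integral>\<^sup>+\<omega>. ennreal ((?f \<omega>)\<^sup>2) \<partial>null_ext L n p lam)"
    unfolding V_def by (rule nn_integral_eq_integral[symmetric, OF null_int]) simp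
  with null have "1 \<le> ennreal V" "ennreal V \<le> ennreal (1 + 2 * real p)" by presburger+
  then have V: "1 \<le> V" "V \<le> 1 + 2 * real p"
    by (simp_all only: ennreal_ge_1 ennreal_le_iff)
  let ?dens = "\<lambda>z. indicator ?E (snd z) / m"
  \<comment> \<open>Conditioning becomes a density on the product of \<open>W\<close> with the
    unconditioned sample, where the mean is already known.\<close>
  have ext: "planted_ext L n p \<mu>' \<rho> lam eps \<iota> =
      distr (density (?G \<Otimes>\<^sub>M ?P) (\<lambda>z. ennreal (?dens z))) (?G \<Otimes>\<^sub>M obs_space n p)
        (\<lambda>z. (fst z, observe n p \<mu>' (snd z)))" if "m > 0"
    unfolding planted_ext_def planted_trunc_def Let_def m_def
    by (rule distr_uniform_measure_pair) (use that in \<open>auto simp: m_def prob_space_gauss prob_space_planted\<close>)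
  have f_comp [measurable]: "(\<lambda>z. ?f (fst z, observe n p \<mu>' (snd z))) \<in> borel_measurable (?G \<Otimes>\<^sub>M ?P)"
    by (rule measurable_compose[OF map_meas f_meas'])
  have dens_meas [measurable]: "?dens \<in> borel_measurable (?G \<Otimes>\<^sub>M ?P)"
    by measurable
  have map_meas': "(\<lambda>z. (fst z, observe n p \<mu>' (snd z))) \<in>
      density (?G \<Otimes>\<^sub>M ?P) (\<lambda>z. ennreal (?dens z)) \<rightarrow>\<^sub>M ?G \<Otimes>\<^sub>M obs_space n p"
    using map_meas by simp
  have ext_int: "integrable (planted_ext L n p \<mu>' \<rho> lam eps \<iota>) ?f" if "m > 0"
    unfolding ext[OF that] integrable_distr_eq[OF map_meas' f_meas']
    using that facts(1) by (subst integrable_density[OF f_comp dens_meas]) (simp_all add: case_prod_unfold)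
  have ext_val: "(LINT \<omega>|planted_ext L n p \<mu>' \<rho> lam eps \<iota>. ?f \<omega>) = (m + b\<^sup>2 * \<mu>' / n * ?S) / m" if "m > 0"
    unfolding ext[OF that] integral_distr[OF map_meas' f_meas']
    using that facts(2) by (subst integral_density[OF f_comp dens_meas]) (simp_all add: case_prod_unfold m_def)
  show "test_function L n p \<mu>' \<rho> lam eps \<iota> ?f" if "m > 0"
    unfolding test_function_def using f_meas null_int ext_int[OF that] by simp
  assume K: "?K > 0"
  \<comment> \<open>On a null event the truncated score would integrate to 0, against its positive
    lower bound.\<close>
  have m: "m > 0"
  proof (rule ccontr)
    assume "\<not> m > 0"
    then have "m = 0" using measure_nonneg[of ?P ?E] by (simp add: m_def)
    then have "?E \<in> null_sets ?P" by (simp add: m_def null_sets_def P.emeasure_eq_measure)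
    then have "AE \<omega> in ?P. \<omega> \<notin> ?E" by (rule AE_not_in)
    then have "AE \<omega> in ?P. indicator ?E \<omega> * (energy p \<omega> * label_score n p \<mu> X \<omega>) = 0"
      by eventually_elim (simp add: indicator_def)
    then have "?S = 0" by (rule integral_eq_zero_AE)
    moreover have "n * ?K > 0" using n K by simp
    ultimately show False using S_ge by linarith
  qed
  \<comment> \<open>Dividing a nonnegative quantity by the probability \<open>m\<close> cannot
    decrease it, and the summand \<open>m\<close> in the numerator is dropped, so conditioning does
    not weaken the bound.\<close>
  have "m \<le> 1" unfolding m_def by simp
  have "b\<^sup>2 * \<mu>' * ?K \<le> b\<^sup>2 * \<mu>' / n * ?S"
    using mult_left_mono[OF S_ge, of "b\<^sup>2 * \<mu>' / n"] \<mu> n by simp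
  moreover have "0 \<le> b\<^sup>2 * \<mu>' * ?K" using \<mu> K by simp
  ultimately have "b\<^sup>2 * \<mu>' * ?K * m \<le> m + b\<^sup>2 * \<mu>' / n * ?S"
    using mult_left_le[OF \<open>m \<le> 1\<close>, of "b\<^sup>2 * \<mu>' * ?K"] m by linarith
  then have "b\<^sup>2 * \<mu>' * ?K \<le> (m + b\<^sup>2 * \<mu>' / n * ?S) / m"
    using m by (simp add: pos_le_divide_eq)
  then have "b\<^sup>2 * \<mu>' * ?K / sqrt (1 + 2 * real p) \<le> (m + b\<^sup>2 * \<mu>' / n * ?S) / m / sqrt V"
    using V \<open>0 \<le> b\<^sup>2 * \<mu>' * ?K\<close> by (intro frac_le) auto
  then show "m > 0 \<and> b\<^sup>2 * \<mu>' * ?K / sqrt (1 + 2 * real p) \<le> Adv L n p \<mu>' \<rho> lam eps \<iota> ?f"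
    using m by (simp add: Adv_def ext_val V_def)
qed

section \<open>The choice of parameters and the limit along the admissible sizes\<close>

lemma threshold_F_increase:
  assumes "\<gamma> > 0" "\<mu>'\<^sup>2 = \<mu>\<^sup>2 + \<gamma> * \<delta>" "\<delta> \<ge> 0"
  shows "threshold_F L \<mu>' \<rho> \<gamma> lam eps \<le> threshold_F L \<mu> \<rho> \<gamma> lam eps + \<delta>"
proof -
  \<comment> \<open>The signal strength enters the maximum only through this quotient, in two of the
    three entries; both rise by \<delta> and the third is unchanged.\<close>
  have "\<mu>'\<^sup>2 / \<gamma> = \<mu>\<^sup>2 / \<gamma> + \<delta>" using assms by (simp add: add_divide_distrib)
  then show ?thesis using assms(3) by (auto simp: threshold_F_def max_def)
qed

lemma filterlim_dim_p:
  assumes "\<gamma> > 0"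
  shows "filterlim (dim_p \<gamma>) at_top (along_sizes \<gamma>)"
proof -
  have "filterlim (dim_p \<gamma>) at_top sequentially"
    unfolding filterlim_at_top
  proof
    fix Z
    show "\<forall>\<^sub>F n in sequentially. Z \<le> dim_p \<gamma> n"
      using eventually_ge_at_top[of "nat \<lceil>Z * \<gamma>\<rceil>"]
    proof eventually_elim
      case (elim n)
      then have "Z * \<gamma> \<le> n" by linarith
      then show ?case
        using assms unfolding dim_p_def by (intro le_nat_floor) (simp add: pos_le_divide_eq)
    qed
  qed
  then show ?thesis
    by (rule filterlim_mono) (simp_all add: along_sizes_def)
qed

lemma eventually_along_sizes: "\<forall>\<^sub>F n in along_sizes \<gamma>. n \<in> sizes \<gamma>"
  by (simp add: along_sizes_def eventually_inf_principal)

theorem lemma2p7: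
  fixes L :: nat and \<mu> \<rho> \<gamma> \<epsilon> :: real and lam eps :: "nat \<Rightarrow> real"
  assumes "L \<ge> 1" and "\<mu> > 0" and "0 < \<rho>" and "\<rho> \<le> 1" and "\<gamma> > 0"
    and "\<And>l. l < L \<Longrightarrow> lam l > 0"
    and "\<And>l. l < L \<Longrightarrow> 0 < eps l \<and> eps l < 1"
    and "\<epsilon> > 0" and "threshold_F L \<mu> \<rho> \<gamma> lam eps < 1 - \<epsilon>"
    and "\<exists>X. weak_recovery L \<mu> \<rho> \<gamma> lam eps X"
  shows "\<exists>\<mu>'>0. \<exists>\<epsilon>'>0. threshold_F L \<mu>' \<rho> \<gamma> lam eps < 1 - \<epsilon>' \<and>
    (\<forall>\<iota>. truncation_const L \<mu>' \<rho> \<gamma> lam eps \<iota> \<longrightarrow>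
      (\<exists>f :: nat \<Rightarrow> (nat \<times> nat \<Rightarrow> real) \<times> observation \<Rightarrow> real.
        (\<forall>n\<in>sizes \<gamma>. test_function L n (dim_p \<gamma> n) \<mu>' \<rho> lam eps \<iota> (f n)) \<and>
        filterlim (\<lambda>n. Adv L n (dim_p \<gamma> n) \<mu>' \<rho> lam eps \<iota> (f n)) at_top (along_sizes \<gamma>)))"
proof -
  obtain X c where est: "\<And>n. n \<in> sizes \<gamma> \<Longrightarrow> estimator L n (dim_p \<gamma> n) (X n)"
    and c: "c > 0" "\<forall>\<^sub>F n in along_sizes \<gamma>. overlap L n (dim_p \<gamma> n) \<mu> \<rho> lam eps (X n) \<ge> c"
    using assms(10) by (auto simp: weak_recovery_def)
  have X: "X n \<in> obs_space n (dim_p \<gamma> n) \<rightarrow>\<^sub>M mat_space n n" if "n \<in> sizes \<gamma>" for n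
    using est[OF that] by (simp add: estimator_def)
  \<comment> \<open>Raises \<open>\<mu>\<^sup>2 / \<gamma>\<close> by \<epsilon> / 2, which uses up
    half of the slack below 1.\<close>
  define \<mu>' where "\<mu>' = sqrt (\<mu>\<^sup>2 + \<gamma> * (\<epsilon> / 2))"
  have \<mu>'2: "\<mu>'\<^sup>2 = \<mu>\<^sup>2 + \<gamma> * (\<epsilon> / 2)"
    using assms(5,8) by (simp add: \<mu>'_def)
  have "\<mu>\<^sup>2 < \<mu>'\<^sup>2" using assms(5,8) by (simp add: \<mu>'2)
  then have lt: "\<mu> < \<mu>'"
    using assms(5,8) by (intro power_less_imp_less_base[of \<mu> 2]) (auto simp: \<mu>'_def)
  then have \<mu>'0: "\<mu>' > 0" using assms(2) by linarith
  have thr: "threshold_F L \<mu>' \<rho> \<gamma> lam eps < 1 - \<epsilon> / 2"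
    using threshold_F_increase[OF assms(5) \<mu>'2, of L \<rho> lam eps] assms(8,9) by simp
  \<comment> \<open>\<open>a\<^sup>2 * \<mu>' = \<mu>\<close> gives the first mixture the strength
    for which the estimator is made; \<open>b\<close> is positive because \<mu> < \<mu>', which
    leaves signal in the second.\<close>
  define a b where "a = sqrt (\<mu> / \<mu>')" and "b = sqrt (1 - \<mu> / \<mu>')"
  have a: "a > 0" using assms(2) \<mu>'0 by (simp add: a_def)
  have frac: "\<mu> / \<mu>' < 1" "\<mu> / \<mu>' > 0" using lt \<mu>'0 assms(2) by simp_all
  then have ab: "a\<^sup>2 + b\<^sup>2 = 1" and b: "b\<^sup>2 > 0" by (simp_all add: a_def b_def)
  have a\<mu>: "a * sqrt \<mu>' = sqrt \<mu>" using \<mu>'0 by (simp add: a_def real_sqrt_divide)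
  show ?thesis
  proof (rule exI[of _ \<mu>'], rule conjI[OF \<mu>'0], rule exI[of _ "\<epsilon> / 2"], intro conjI allI impI)
    show "\<epsilon> / 2 > 0" "threshold_F L \<mu>' \<rho> \<gamma> lam eps < 1 - \<epsilon> / 2"
      using assms(8) thr by simp_all
    fix \<iota> assume "truncation_const L \<mu>' \<rho> \<gamma> lam eps \<iota>"
    then have \<iota>: "0 < \<iota>" "\<iota> < 1" by (simp_all add: truncation_const_def)
    define p where "p = dim_p \<gamma>"
    define pos where "pos = (\<lambda>n. measure (planted L n (p n) \<rho> lam eps)
      (truncation_event (p n) \<iota> \<inter> space (planted L n (p n) \<rho> lam eps)) > 0)"
    \<comment> \<open>If the truncation event is null, \<^const>\<open>uniform_measure\<close> is not a probability measure; this can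
      only concern finitely many \<open>n\<close>.\<close>
    define f where "f = (\<lambda>n. if pos n \<and> p n > 0 then test_stat n (p n) a b (X n) else (\<lambda>_. 0))"
    have "test_function L n (dim_p \<gamma> n) \<mu>' \<rho> lam eps \<iota> (f n)" if n: "n \<in> sizes \<gamma>" for n
    proof (cases "pos n \<and> p n > 0")
      case True
      have "n > 0" using n by (simp add: sizes_def)
      with True show ?thesis
        using Adv_test_stat_ge(1)[OF X[OF n] ab a \<iota> _ _ _ _ a\<mu>] \<mu>'0 assms(2)
        by (simp add: f_def pos_def p_def)
    next
      case False
      \<comment> \<open>The zero function is integrable under any measure, even a degenerate
        conditional law.\<close>
      then show ?thesis by (auto simp: f_def test_function_def)
    qed
    moreover have "filterlim (\<lambda>n. Adv L n (dim_p \<gamma> n) \<mu>' \<rho> lam eps \<iota> (f n)) at_top (along_sizes \<gamma>)"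
    proof (rule filterlim_at_top_mono)
      define C where "C = b\<^sup>2 * \<mu>'"
      have C: "C > 0" using b \<mu>'0 by (simp add: C_def)
      \<comment> \<open>The lower bound on the advantage with the overlap replaced by
        \<open>c\<close>; a linear numerator over a square root grows like
        \<open>sqrt p\<close>.\<close>
      define g where "g = (\<lambda>p :: nat. C * (p * c - 3 / 2 * sqrt p / \<iota>) / sqrt (1 + 2 * real p))"
      have "filterlim g at_top at_top"
        unfolding g_def using C c(1) \<iota>(1) by real_asymp
      then show "filterlim (\<lambda>n. g (p n)) at_top (along_sizes \<gamma>)"
        using filterlim_dim_p[OF assms(5)] unfolding p_def by (rule filterlim_compose)
      \<comment> \<open>The linear term eventually dominates the \<open>sqrt p\<close> error of the
        truncation, as \<open>Adv_test_stat_ge(2)\<close> requires.\<close>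
      have "\<forall>\<^sub>F p :: nat in at_top. real p > 0 \<and> p * c - 3 / 2 * sqrt p / \<iota> > 0"
        using c(1) \<iota>(1) by (intro eventually_conj) real_asymp+
      then have "\<forall>\<^sub>F n in along_sizes \<gamma>. p n > 0 \<and> p n * c - 3 / 2 * sqrt (p n) / \<iota> > 0"
        using eventually_compose_filterlim[OF _ filterlim_dim_p[OF assms(5)]] by (simp add: p_def)
      with c(2) eventually_along_sizes[of \<gamma>]
      show "\<forall>\<^sub>F n in along_sizes \<gamma>. g (p n) \<le> Adv L n (dim_p \<gamma> n) \<mu>' \<rho> lam eps \<iota> (f n)"
      proof eventually_elim
        case (elim n)
        then have n: "n > 0" by (simp add: sizes_def)
        let ?ov = "overlap L n (p n) \<mu> \<rho> lam eps (X n)"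
        have ov: "p n * c \<le> p n * ?ov" using elim(1) by (intro mult_left_mono) (auto simp: p_def)
        with elim(3) have K: "p n * ?ov - 3 / 2 * sqrt (p n) / \<iota> > 0" by linarith
        have Xn: "X n \<in> obs_space n (p n) \<rightarrow>\<^sub>M mat_space n n" using X[OF elim(2)] by (simp only: p_def)
        have pn: "p n > 0" using elim(3) by simp
        have *: "pos n" "C * (p n * ?ov - 3 / 2 * sqrt (p n) / \<iota>) / sqrt (1 + 2 * real (p n)) \<le>
            Adv L n (p n) \<mu>' \<rho> lam eps \<iota> (test_stat n (p n) a b (X n))"
          using Adv_test_stat_ge(2)[OF Xn ab a \<iota> n pn less_imp_le[OF assms(2)] less_imp_le[OF \<mu>'0] a\<mu>,
              OF K]
          unfolding pos_def C_def by blast+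
        have "g (p n) \<le> C * (p n * ?ov - 3 / 2 * sqrt (p n) / \<iota>) / sqrt (1 + 2 * real (p n))"
          unfolding g_def using C by (intro divide_right_mono mult_left_mono diff_right_mono ov) simp_all
        also note *(2)
        \<comment> \<open>Both conditions in the definition of \<open>f\<close> now hold, so the
          zero branch is excluded.\<close>
        also have "test_stat n (p n) a b (X n) = f n"
          using *(1) pn by (simp only: f_def simp_thms if_True)
        finally show ?case by (simp only: p_def)
      qed
    qed
    ultimately show "\<exists>f :: nat \<Rightarrow> (nat \<times> nat \<Rightarrow> real) \<times> observation \<Rightarrow> real.
        (\<forall>n\<in>sizes \<gamma>. test_function L n (dim_p \<gamma> n) \<mu>' \<rho> lam eps \<iota> (f n)) \<and>
        filterlim (\<lambda>n. Adv L n (dim_p \<gamma> n) \<mu>' \<rho> lam eps \<iota> (f n)) at_top (along_sizes \<gamma>)"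
      by blast
  qed
qed

end
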